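(* Let $p\in[0,1]$ and let $(X,Y)$ be the symmetric binary erasure source with erasure probability $p$, i.e., $X\sim\mathrm{Bern}(1/2)$ and, independently of $X$, an erasure occurs with probability $p$, so that $Y=X$ with probability $1-p$ and $Y=e$ (erasure symbol) with probability $p$. Then $\overline{G}(X;Y)=J(X;Y)$.
   Context: All random variables are discrete, $X$ and $Y$ have finite alphabets, $H$ denotes Shannon entropy and $I$ mutual information (logs base 2). $X\to W\to Y$ means that $X$ and $Y$ are conditionally independent given $W$, where $(X,Y)$ keeps its prescribed joint pmf. The common entropy is $G(X;Y)=\min_{W:\,X\to W\to Y}H(W)$, the minimum being over all discrete $W$ jointly distributed with $(X,Y)$ such that $X\to W\to Y$. For $(X_i,Y_i)$, $i=1,\dots,n$, i.i.d. copies of $(X,Y)$, $G(X^n;Y^n)=\min_{W_n:\,X^n\to W_n\to Y^n}H(W_n)$, and $\overline{G}(X;Y)=\lim_{n\to\infty}\frac1n G(X^n;Y^n)$ (this limit exists and equals $\inf_n \frac1n G(X^n;Y^n)$). The Wyner common information is $J(X;Y)=\min_{W:\,X\to W\to Y}I(W;X,Y)$. *)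

theory Defs
  imports "HOL-Probability.Probability"
begin

text \<open>
  Shannon entropy in bits, as the expected self-information.  It is extended-valued because a
  distribution on a countably infinite alphabet may have infinite entropy, whereas the real-valued
  \<open>prob_space.entropy\<close> is \<open>0\<close> for such a distribution.  The two agree whenever the entropy is
  finite (lemma \<open>shannon_entropy_eq_entropy\<close>).
\<close>

definition shannon_entropy :: "'a pmf \<Rightarrow> ereal" where
  "shannon_entropy q = enn2ereal (\<integral>\<^sup>+ w. ennreal (- log 2 (pmf q w)) \<partial>measure_pmf q)"

lemma shannon_entropy_eq_entropy:
  fixes q :: "'a :: countable pmf"
  assumes "shannon_entropy q < \<infinity>"
  shows "shannon_entropy q = ereal (prob_space.entropy (measure_pmf q) 2 (count_space UNIV) (\<lambda>w. w))"
proof -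
  interpret information_space "measure_pmf q" 2
    by unfold_locales simp
  have D: "distributed (measure_pmf q) (count_space UNIV) (\<lambda>w. w) (\<lambda>w. ennreal (pmf q w))"
    unfolding distributed_def measure_pmf_eq_density[symmetric] by (simp add: distr_id2)
  have nn: "0 \<le> - log 2 (pmf q w)" if "w \<in> set_pmf q" for w
    using that pmf_le_1[of q w] by (auto simp: pmf_positive log_le_zero_cancel_iff)
  have I: "(\<integral>\<^sup>+ w. ennreal (- log 2 (pmf q w)) \<partial>measure_pmf q) < \<infinity>"
    using assms unfolding shannon_entropy_def
    by (auto simp: less_top[symmetric] simp flip: top_ereal_def)
  have "integrable (measure_pmf q) (\<lambda>w. - log 2 (pmf q w))"
    using I nn by (intro integrableI_nonneg) (auto simp: AE_measure_pmf_iff)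
  then have "(\<integral>\<^sup>+ w. ennreal (- log 2 (pmf q w)) \<partial>measure_pmf q) =
      ennreal (\<integral>w. - log 2 (pmf q w) \<partial>measure_pmf q)"
    using nn by (intro nn_integral_eq_integral) (auto simp: AE_measure_pmf_iff)
  moreover have "0 \<le> (\<integral>w. - log 2 (pmf q w) \<partial>measure_pmf q)"
    using nn by (intro integral_nonneg_AE) (auto simp: AE_measure_pmf_iff)
  moreover have "(\<integral>w. - log 2 (pmf q w) \<partial>measure_pmf q) =
      prob_space.entropy (measure_pmf q) 2 (count_space UNIV) (\<lambda>w. w)"
    by (subst entropy_distr[OF D]) (simp_all add: measure_pmf_eq_density[of q] integral_density)
  ultimately show ?thesis
    unfolding shannon_entropy_def by (simp add: enn2ereal_ennreal)
qed

text \<open>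
  \<open>R\<close> is a joint distribution of \<open>(X, Y, W)\<close> under which \<open>(X, Y)\<close> has distribution \<open>P\<close> and
  \<open>X\<close> and \<open>Y\<close> are conditionally independent given \<open>W\<close>.  For \<open>w\<close> outside the support of \<open>W\<close> both
  sides of the second condition are \<open>0\<close>.
\<close>

definition markov_coupling :: "('a \<times> 'b) pmf \<Rightarrow> ('a \<times> 'b \<times> 'w) pmf \<Rightarrow> bool" where
  "markov_coupling P R \<longleftrightarrow>
     map_pmf (\<lambda>(x, y, w). (x, y)) R = P \<and>
     (\<forall>x y w. \<P>((x', y', w') in measure_pmf R. x' = x \<and> y' = y \<bar> w' = w) =
        \<P>((x', y', w') in measure_pmf R. x' = x \<bar> w' = w) *
        \<P>((x', y', w') in measure_pmf R. y' = y \<bar> w' = w))"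

text \<open>
  The alphabet of \<open>W\<close> is \<open>nat\<close>: entropy, mutual information and conditional independence are
  invariant under injective relabelling of \<open>W\<close>, and every discrete random variable takes values in
  a countable set.
\<close>

definition common_entropy :: "('a \<times> 'b) pmf \<Rightarrow> ereal" where
  "common_entropy P =
     (INF R \<in> {R :: ('a \<times> 'b \<times> nat) pmf. markov_coupling P R}.
        shannon_entropy (map_pmf (\<lambda>(x, y, w). w) R))"

definition iid_source :: "nat \<Rightarrow> ('a \<times> 'b) pmf \<Rightarrow> ('a list \<times> 'b list) pmf" where
  "iid_source n P = map_pmf (\<lambda>zs. (map fst zs, map snd zs)) (replicate_pmf n P)"

definition common_entropy_rate :: "('a :: finite \<times> 'b :: finite) pmf \<Rightarrow> ereal" where
  "common_entropy_rate P = lim (\<lambda>n. common_entropy (iid_source n P) / ereal (real n))"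

text \<open>
  Since \<open>X\<close> and \<open>Y\<close> have finite alphabets, the integral behind \<open>mutual_information\<close> converges for
  every \<open>W\<close>, also when \<open>W\<close> has infinite entropy.
\<close>

definition wyner_common_information :: "('a :: finite \<times> 'b :: finite) pmf \<Rightarrow> ereal" where
  "wyner_common_information P =
     (INF R \<in> {R :: ('a \<times> 'b \<times> nat) pmf. markov_coupling P R}.
        ereal (prob_space.mutual_information (measure_pmf R) 2 (count_space UNIV) (count_space UNIV)
          (\<lambda>(x, y, w). w) (\<lambda>(x, y, w). (x, y))))"

text \<open>\<open>None\<close> is the erasure symbol.\<close>

definition erasure_source :: "real \<Rightarrow> (bool \<times> bool option) pmf" where
  "erasure_source p =
     do {
       x \<leftarrow> bernoulli_pmf (1/2);
       erased \<leftarrow> bernoulli_pmf p;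
       return_pmf (x, if erased then None else Some x)
     }"

end

theory Submission
  imports Defs "HOL-Real_Asymp.Real_Asymp"
begin

text \<open>
  Let \<open>c y\<close> be \<open>1 / Pr(E = e)\<close> for the erasure indicator \<open>e\<close> of \<open>y\<close> if \<open>p \<ge> 1/2\<close>, and \<open>2\<close>
  otherwise.  If \<open>X\<close> and \<open>Y\<close> are conditionally independent given \<open>W\<close>, then the pairs \<open>(x, y)\<close>
  compatible with a value of \<open>W\<close> form a rectangle \<open>A \<times> B\<close> inside the support of the source, and for
  the erasure source every such rectangle satisfies \<open>\<Sum>(x,y)\<in>A\<times>B. P(x,y) c(y) \<le> 1\<close>.  This bound
  tensorizes, and by Gibbs' inequality it gives \<open>I(W; X\<^sup>n, Y\<^sup>n) \<ge> n E[log c(Y)]\<close>.  Hence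
  \<open>E[log c(Y)]\<close> is a lower bound for \<open>J\<close> and for every \<open>G(X\<^sup>n; Y\<^sup>n) / n\<close>.

  For \<open>J\<close> the bound is attained by an erasure channel \<open>X \<rightarrow> W \<rightarrow> Y\<close>.  For \<open>G\<close> it is attained
  asymptotically by a covering code: if \<open>m \<le> n/2\<close> positions are unerased, choose a superset of them
  from a family of about \<open>(n choose m) / 4\<^sup>m\<close> sets of size \<open>2 m\<close>, and let \<open>W\<close> be this set together
  with the \<open>2 m\<close> bits of \<open>X\<close> on it.  Up to \<open>O(log n)\<close>, describing \<open>W\<close> costs \<open>log (n choose m)\<close> bits,
  which is at most the self-information of the erasure pattern; if \<open>m > n/2\<close> and \<open>p \<ge> 1/2\<close>, that
  self-information is at least \<open>n\<close>, so that \<open>W = X\<^sup>n\<close> is good enough.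
\<close>

section \<open>Information density\<close>

text \<open>Its expectation under \<open>Q\<close> is the mutual information of the two coordinates.
  Since \<open>z\<close> ranges over any type, single letters and whole blocks are treated
  alike.\<close>

definition info_density :: "('z \<times> 'w) pmf \<Rightarrow> 'z \<times> 'w \<Rightarrow> real" where
  "info_density Q zw =
     log 2 (pmf Q zw / (pmf (map_pmf fst Q) (fst zw) * pmf (map_pmf snd Q) (snd zw)))"

lemma pmf_le_pmf_fst: "pmf Q (z, w) \<le> pmf (map_pmf fst Q) z"
  unfolding pmf_map by (simp add: pmf.rep_eq, rule measure_pmf.finite_measure_mono) auto

lemma pmf_le_pmf_snd: "pmf Q (z, w) \<le> pmf (map_pmf snd Q) w"
  unfolding pmf_map by (simp add: pmf.rep_eq, rule measure_pmf.finite_measure_mono) auto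

lemma pmf_marginal_pos:
  assumes "(z, w) \<in> set_pmf Q"
  shows "0 < pmf Q (z, w)" "0 < pmf (map_pmf fst Q) z" "0 < pmf (map_pmf snd Q) w"
  using pmf_positive[OF assms] pmf_le_pmf_fst[of Q z w] pmf_le_pmf_snd[of Q z w] by auto

text \<open>On the support of \<open>Q\<close> the quotient is the density of the product of the
  marginals with respect to \<open>Q\<close>. That product may charge points off the support, hence
  the indicator. Integrating over \<open>w\<close> last allows bounds for each fixed
  \<open>w\<close> to be applied.\<close>

lemma nn_integral_change_to_product:
  fixes f :: "'z \<Rightarrow> ennreal" and Q :: "('z \<times> 'w) pmf"
  shows "(\<integral>\<^sup>+ zw. f (fst zw) * ennreal (pmf (map_pmf fst Q) (fst zw) * pmf (map_pmf snd Q) (snd zw) / pmf Q zw) \<partial>Q)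
     = (\<integral>\<^sup>+ w. \<integral>\<^sup>+ z. f z * indicator {z. (z, w) \<in> set_pmf Q} z \<partial>map_pmf fst Q \<partial>map_pmf snd Q)"
    (is "?l = ?r")
proof -
  let ?P = "map_pmf fst Q" and ?W = "map_pmf snd Q"
  have "?l = (\<integral>\<^sup>+ zw. ennreal (pmf (pair_pmf ?P ?W) zw) * (f (fst zw) * indicator (set_pmf Q) zw)
      \<partial>count_space UNIV)"
    unfolding nn_integral_measure_pmf[of Q]
  proof (rule nn_integral_cong, goal_cases)
    case (1 zw)
    obtain z w where zw: "zw = (z, w)" by force
    have "ennreal a * (x * ennreal (b / a)) = ennreal b * x" if "a > 0" "b \<ge> 0" for a b x
    proof -
      have "ennreal a * (x * ennreal (b / a)) = (ennreal a * ennreal (b / a)) * x"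
        by (simp add: mult_ac)
      also have "ennreal a * ennreal (b / a) = ennreal b"
        using that by (simp flip: ennreal_mult)
      finally show ?thesis .
    qed
    from this[of "pmf Q zw"] show ?case
      by (auto simp: zw pmf_pair indicator_def pmf_positive pmf_eq_0_set_pmf simp del: pmf_map)
  qed
  also have "\<dots> = (\<integral>\<^sup>+ zw. f (fst zw) * indicator (set_pmf Q) zw \<partial>pair_pmf ?P ?W)"
    unfolding nn_integral_measure_pmf[of "pair_pmf ?P ?W"] ..
  also have "\<dots> = (\<integral>\<^sup>+ zw. f (snd zw) * indicator (set_pmf Q) (snd zw, fst zw) \<partial>pair_pmf ?W ?P)"
    by (subst pair_commute_pmf) (simp add: case_prod_unfold del: nn_integral_pair_pmf')
  also have "\<dots> = ?r"
    unfolding nn_integral_pair_pmf' by (simp add: indicator_def)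
  finally show ?thesis .
qed

lemma log2_inverse_ge: "0 < (v :: real) \<Longrightarrow> (1 - v) / ln 2 \<le> - log 2 v"
  using divide_right_mono[of "1 - v" "- ln v" "ln 2"] ln_le_minus_one[of v] by (simp add: log_def)

text \<open>Gibbs' inequality: \<open>c z\<close> times the inverse density ratio has mean at most 1
  under \<open>Q\<close>, being an average over \<open>w\<close> of the integrals bounded in the
  second premise, so its logarithm has nonpositive mean. Integrability needs its own argument,
  because \<open>w\<close> may have infinite entropy.\<close>

lemma
  fixes Q :: "('z \<times> 'w) pmf"
  assumes fin: "finite (set_pmf (map_pmf fst Q))"
  shows integrable_info_density: "integrable Q (info_density Q)"
    and expectation_info_density_ge:
      "\<lbrakk>\<And>z. z \<in> set_pmf (map_pmf fst Q) \<Longrightarrow> 0 < c z;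
        \<And>w. w \<in> set_pmf (map_pmf snd Q) \<Longrightarrow>
          (\<integral>\<^sup>+ z. ennreal (c z) * indicator {z. (z, w) \<in> set_pmf Q} z \<partial>map_pmf fst Q) \<le> 1\<rbrakk>
       \<Longrightarrow> measure_pmf.expectation (map_pmf fst Q) (\<lambda>z. log 2 (c z)) \<le>
           measure_pmf.expectation Q (info_density Q)"
proof -
  let ?P = "map_pmf fst Q" and ?W = "map_pmf snd Q"
  define r where "r zw = pmf ?P (fst zw) * pmf ?W (snd zw) / pmf Q zw" for zw
  have r_pos: "r zw > 0" if "zw \<in> set_pmf Q" for zw
    using pmf_marginal_pos[of "fst zw" "snd zw" Q] that unfolding r_def by simp
  have dens: "info_density Q zw = - log 2 (r zw)" if "zw \<in> set_pmf Q" for zw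
    using pmf_marginal_pos[of "fst zw" "snd zw" Q] that
    unfolding r_def info_density_def by (simp add: log_divide log_mult del: pmf_map)
  have int: "integrable Q (\<lambda>zw. c (fst zw) * r zw) \<and>
      measure_pmf.expectation Q (\<lambda>zw. c (fst zw) * r zw) \<le> K"
    if c: "\<And>z. z \<in> set_pmf ?P \<Longrightarrow> 0 < c z" and K: "K \<ge> 0" and
      b: "\<And>w. w \<in> set_pmf ?W \<Longrightarrow>
          (\<integral>\<^sup>+ z. ennreal (c z) * indicator {z. (z, w) \<in> set_pmf Q} z \<partial>?P) \<le> ennreal K"
    for c :: "'z \<Rightarrow> real" and K
  proof -
    have pos: "AE zw in Q. 0 \<le> c (fst zw) * r zw"
      by (auto simp: AE_measure_pmf_iff intro!: mult_nonneg_nonneg less_imp_le[OF c] less_imp_le[OF r_pos])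
        force
    have "(\<integral>\<^sup>+ zw. ennreal (c (fst zw) * r zw) \<partial>Q) = (\<integral>\<^sup>+ zw. ennreal (c (fst zw)) * ennreal (r zw) \<partial>Q)"
      by (intro nn_integral_cong_AE)
        (auto simp: AE_measure_pmf_iff intro!: ennreal_mult less_imp_le[OF c] less_imp_le[OF r_pos], force)
    also have "\<dots> = (\<integral>\<^sup>+ w. \<integral>\<^sup>+ z. ennreal (c z) * indicator {z. (z, w) \<in> set_pmf Q} z \<partial>?P \<partial>?W)"
      unfolding r_def by (rule nn_integral_change_to_product)
    also have "\<dots> \<le> (\<integral>\<^sup>+ w. ennreal K \<partial>?W)"
      by (intro nn_integral_mono_AE) (use b in \<open>simp only: AE_measure_pmf_iff, blast\<close>)
    finally have le: "(\<integral>\<^sup>+ zw. ennreal (c (fst zw) * r zw) \<partial>Q) \<le> ennreal K"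
      by (simp add: measure_pmf.emeasure_space_1)
    have i: "integrable Q (\<lambda>zw. c (fst zw) * r zw)"
      using pos le by (intro integrableI_nonneg) (auto simp: le_less_trans)
    moreover have "measure_pmf.expectation Q (\<lambda>zw. c (fst zw) * r zw) \<le> K"
      using nn_integral_eq_integral[OF i pos] le K by (simp add: ennreal_le_iff)
    ultimately show ?thesis by simp
  qed

  \<comment> \<open>With this weight, \<open>d z * r (z, w)\<close> is the inverse conditional
    probability of \<open>z\<close> given \<open>w\<close>: at least 1 on the support, and of mean
    at most the number of possible \<open>z\<close>.\<close>
  define d where "d z = 1 / pmf ?P z" for z
  have d: "z \<in> set_pmf ?P \<Longrightarrow> 0 < d z" for z
    unfolding d_def by (intro divide_pos_pos pmf_positive) auto
  have "(\<integral>\<^sup>+ z. ennreal (d z) * indicator {z. (z, w) \<in> set_pmf Q} z \<partial>?P) \<le> ennreal (card (set_pmf ?P))" for w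
  proof -
    have "(\<integral>\<^sup>+ z. ennreal (d z) * indicator {z. (z, w) \<in> set_pmf Q} z \<partial>?P)
        \<le> (\<integral>\<^sup>+ z. ennreal (d z) \<partial>?P)"
      by (intro nn_integral_mono) (simp split: split_indicator)
    also have "\<dots> = (\<Sum>z\<in>set_pmf ?P. ennreal (d z) * ennreal (pmf ?P z))"
      by (rule nn_integral_measure_pmf_finite[OF fin]) simp
    also have "\<dots> = (\<Sum>z\<in>set_pmf ?P. 1)"
      unfolding d_def by (intro sum.cong refl) (auto simp flip: ennreal_mult simp: set_pmf_eq simp del: pmf_map set_map_pmf)
    finally show ?thesis by (simp add: ennreal_of_nat_eq_real_of_nat)
  qed
  from int[OF d _ this] have id: "integrable Q (\<lambda>zw. d (fst zw) * r zw)" by simp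

  have fin_int: "integrable Q (\<lambda>zw. g (fst zw))" for g :: "'z \<Rightarrow> real"
    using integrable_measure_pmf_finite[OF fin, of g] by simp
  \<comment> \<open>The density is \<open>log 2 (d z)\<close>, which takes finitely many values,
    minus the logarithm of \<open>d z * r (z, w)\<close>, which lies between 0 and that number
    divided by \<open>ln 2\<close>. This gives an integrable majorant.\<close>
  have bound: "norm (info_density Q zw) \<le> (d (fst zw) * r zw) / ln 2 + \<bar>log 2 (d (fst zw))\<bar>"
    if "zw \<in> set_pmf Q" for zw
  proof -
    obtain z w where zw: "zw = (z, w)" by force
    note pos = pmf_marginal_pos[OF that[unfolded zw]]
    let ?u = "d z * r (z, w)"
    have u: "?u = pmf ?W w / pmf Q (z, w)" using pos unfolding d_def r_def zw by simp
    have "?u \<ge> 1" using pos pmf_le_pmf_snd[of Q z w] unfolding u by simp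
    then have l: "0 \<le> log 2 ?u" by simp
    have "log 2 ?u \<le> ?u / ln 2"
      using ln_le_minus_one[of ?u] \<open>?u \<ge> 1\<close> by (simp add: log_def divide_right_mono)
    moreover have "info_density Q zw = log 2 (d z) - log 2 ?u"
      using pos d[of z] r_pos[OF that] \<open>?u \<ge> 1\<close> that unfolding dens[OF that]
      by (subst log_mult) (auto simp: zw, force?)
    ultimately show ?thesis using l by (simp add: zw)
  qed
  show integrable: "integrable Q (info_density Q)"
  proof (rule Bochner_Integration.integrable_bound)
    show "integrable Q (\<lambda>zw. (d (fst zw) * r zw) / ln 2 + \<bar>log 2 (d (fst zw))\<bar>)"
      using id fin_int[of "\<lambda>z. \<bar>log 2 (d z)\<bar>"] by simp
    show "AE zw in Q. norm (info_density Q zw) \<le> norm ((d (fst zw) * r zw) / ln 2 + \<bar>log 2 (d (fst zw))\<bar>)"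
      unfolding AE_measure_pmf_iff using bound by (auto intro: order_trans[OF _ abs_ge_self])
  qed simp

  assume c: "\<And>z. z \<in> set_pmf ?P \<Longrightarrow> 0 < c z"
    and b: "\<And>w. w \<in> set_pmf ?W \<Longrightarrow>
          (\<integral>\<^sup>+ z. ennreal (c z) * indicator {z. (z, w) \<in> set_pmf Q} z \<partial>?P) \<le> 1"
  have ic: "integrable Q (\<lambda>zw. c (fst zw) * r zw)"
    and Ec: "measure_pmf.expectation Q (\<lambda>zw. c (fst zw) * r zw) \<le> 1"
    using int[of c 1] c b by simp_all
  have "0 \<le> measure_pmf.expectation Q (\<lambda>zw. (1 - c (fst zw) * r zw) / ln 2)"
    using ic Ec by simp
  also have "\<dots> \<le> measure_pmf.expectation Q (\<lambda>zw. info_density Q zw - log 2 (c (fst zw)))"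
  proof (rule integral_mono_AE)
    show "AE zw in Q. (1 - c (fst zw) * r zw) / ln 2 \<le> info_density Q zw - log 2 (c (fst zw))"
    proof (simp only: AE_measure_pmf_iff, intro ballI)
      fix zw assume zw: "zw \<in> set_pmf Q"
      then have "c (fst zw) > 0" by (intro c) auto
      with r_pos[OF zw] log2_inverse_ge[of "c (fst zw) * r zw"]
      show "(1 - c (fst zw) * r zw) / ln 2 \<le> info_density Q zw - log 2 (c (fst zw))"
        by (simp add: dens[OF zw] log_mult)
    qed
  qed (use ic integrable fin_int[of "\<lambda>z. log 2 (c z)"] in auto)
  also have "\<dots> = measure_pmf.expectation Q (info_density Q) -
      measure_pmf.expectation ?P (\<lambda>z. log 2 (c z))"
    using integrable fin_int[of "\<lambda>z. log 2 (c z)"] by simp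
  finally show "measure_pmf.expectation ?P (\<lambda>z. log 2 (c z)) \<le>
           measure_pmf.expectation Q (info_density Q)"
    by simp
qed

text \<open>The density is the self-information of \<open>w\<close> plus the logarithm of the
  conditional probability of \<open>w\<close> given \<open>z\<close>, which is nonpositive. Infinite
  entropy is the trivial case.\<close>

lemma shannon_entropy_ge_info_density:
  fixes Q :: "('z \<times> 'w) pmf"
  assumes "finite (set_pmf (map_pmf fst Q))"
  shows "ereal (measure_pmf.expectation Q (info_density Q)) \<le> shannon_entropy (map_pmf snd Q)"
proof -
  let ?E = "measure_pmf.expectation Q (info_density Q)" and ?W = "map_pmf snd Q"
  let ?H = "\<integral>\<^sup>+ w. ennreal (- log 2 (pmf ?W w)) \<partial>?W"
  have "(\<integral>\<^sup>+ zw. ennreal (info_density Q zw) \<partial>Q) \<le> (\<integral>\<^sup>+ zw. ennreal (- log 2 (pmf ?W (snd zw))) \<partial>Q)"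
  proof (intro nn_integral_mono_AE, simp only: AE_measure_pmf_iff, intro ballI ennreal_leI)
    fix zw assume *: "zw \<in> set_pmf Q"
    obtain z w where zw: "zw = (z, w)" by force
    note pos = pmf_marginal_pos[OF *[unfolded zw]]
    have "info_density Q zw = log 2 (pmf Q zw / pmf (map_pmf fst Q) z) - log 2 (pmf ?W w)"
      using pos unfolding info_density_def by (simp add: zw log_divide log_mult del: pmf_map)
    moreover have "log 2 (pmf Q zw / pmf (map_pmf fst Q) z) \<le> 0"
      using pos pmf_le_pmf_fst[of Q z w] by (simp add: zw del: pmf_map)
    ultimately show "info_density Q zw \<le> - log 2 (pmf ?W (snd zw))" by (simp add: zw)
  qed
  also have "\<dots> = ?H" by simp
  finally have le: "(\<integral>\<^sup>+ zw. ennreal (info_density Q zw) \<partial>Q) \<le> ?H" .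
  show ?thesis
  proof (cases ?H)
    case (real h)
    with integral_real_bounded[of h Q "info_density Q"] le have "?E \<le> h" by simp
    with real show ?thesis by (simp add: shannon_entropy_def enn2ereal_ennreal)
  qed (simp add: shannon_entropy_def)
qed

text \<open>The mutual information takes \<open>w\<close> first and the pair second, so the joint
  pmf is swapped. Countability makes the product of the counting measures a counting measure, for
  which the pmfs are the densities.\<close>

lemma mutual_information_eq_expectation:
  fixes R :: "('x :: countable \<times> 'y :: countable \<times> 'w :: countable) pmf"
  shows "prob_space.mutual_information (measure_pmf R) 2 (count_space UNIV) (count_space UNIV)
          (\<lambda>(x, y, w). w) (\<lambda>(x, y, w). (x, y)) =
    measure_pmf.expectation (map_pmf (\<lambda>(x, y, w). ((x, y), w)) R)
      (info_density (map_pmf (\<lambda>(x, y, w). ((x, y), w)) R))"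
proof -
  interpret information_space "measure_pmf R" 2 by unfold_locales simp
  define Q where "Q = map_pmf (\<lambda>(x, y, w). ((x, y), w)) R"
  have dist: "distributed (measure_pmf R) (count_space UNIV) f (\<lambda>w. ennreal (pmf (map_pmf f R) w))"
    for f :: "'x \<times> 'y \<times> 'w \<Rightarrow> 'v"
    unfolding distributed_def measure_pmf_eq_density[symmetric] by (simp add: map_pmf_rep_eq)
  have prod: "count_space UNIV \<Otimes>\<^sub>M count_space UNIV = (count_space UNIV :: ('w \<times> 'x \<times> 'y) measure)"
    by (simp add: pair_measure_countable)
  let ?W = "map_pmf (\<lambda>(x, y, w). w) R" and ?P = "map_pmf (\<lambda>(x, y, w). (x, y)) R"
  let ?S = "map_pmf (\<lambda>s. ((\<lambda>(x, y, w). w) s, (\<lambda>(x, y, w). (x, y)) s)) R"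
  have S: "?S = map_pmf prod.swap Q" unfolding Q_def by (simp add: map_pmf_comp case_prod_unfold)
  have W: "?W = map_pmf snd Q" and P: "?P = map_pmf fst Q"
    unfolding Q_def by (simp_all add: map_pmf_comp case_prod_unfold)
  have "prob_space.mutual_information (measure_pmf R) 2 (count_space UNIV) (count_space UNIV)
          (\<lambda>(x, y, w). w) (\<lambda>(x, y, w). (x, y)) =
     (\<integral>s. pmf ?S s * log 2 (pmf ?S s / (pmf ?W (fst s) * pmf ?P (snd s)))
        \<partial>(count_space UNIV \<Otimes>\<^sub>M count_space UNIV))"
    by (rule mutual_information_distr)
      (simp_all only: prod dist sigma_finite_measure_count_space_countable[OF countableI_type] pmf_nonneg)
  also have "\<dots> = (\<integral>s. pmf ?S s * log 2 (pmf ?S s / (pmf ?W (fst s) * pmf ?P (snd s))) \<partial>count_space UNIV)"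
    by (simp only: prod)
  also have "\<dots> = measure_pmf.expectation ?S (\<lambda>s. log 2 (pmf ?S s / (pmf ?W (fst s) * pmf ?P (snd s))))"
    by (subst measure_pmf_eq_density[of ?S], subst integral_density) simp_all
  also have "\<dots> = measure_pmf.expectation Q (info_density Q)"
    unfolding S W P info_density_def
    by (simp only: integral_map_pmf fst_swap snd_swap pmf_map_inj'[OF inj_swap] mult.commute)
  finally show ?thesis unfolding Q_def .
qed

section \<open>The lower bound for rectangle-bounded sources\<close>

text \<open>Given \<open>w\<close>, both factors of the conditional probability are positive, hence
  so is their product.\<close>

lemma markov_coupling_rectangle:
  assumes "markov_coupling P R" and "(x, y', w) \<in> set_pmf R" and "(x', y, w) \<in> set_pmf R"
  shows "(x, y, w) \<in> set_pmf R"
proof -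
  have prob_pos: "0 < measure_pmf.prob R S" if "s \<in> set_pmf R" "s \<in> S" for s S
    using that by (meson measure_pmf_posI)
  have "0 < \<P>((x', y', w') in measure_pmf R. x' = x \<bar> w' = w)"
    unfolding cond_prob_def using assms(2)
    by (intro divide_pos_pos prob_pos) (auto split: prod.splits)
  moreover have "0 < \<P>((x', y', w') in measure_pmf R. y' = y \<bar> w' = w)"
    unfolding cond_prob_def using assms(3)
    by (intro divide_pos_pos prob_pos) (auto split: prod.splits)
  ultimately have "0 < \<P>((x', y', w') in measure_pmf R. x' = x \<and> y' = y \<bar> w' = w)"
    using assms(1) unfolding markov_coupling_def by simp
  then have "measure_pmf.prob R {(x', y', w'). (x' = x \<and> y' = y) \<and> w' = w} \<noteq> 0"
    unfolding cond_prob_def by (auto simp: case_prod_unfold)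
  then show ?thesis
    by (auto simp: measure_pmf_zero_iff)
qed

text \<open>A dual certificate for minimizing over \<open>W\<close>: the pairs compatible with one
  value of \<open>W\<close> form a rectangle inside the support, so no value can gather more than
  unit \<open>c\<close>-weighted mass.\<close>

definition rectangle_bounded :: "('x \<times> 'y) pmf \<Rightarrow> ('x \<times> 'y \<Rightarrow> real) \<Rightarrow> bool" where
  "rectangle_bounded P c \<longleftrightarrow>
     (\<forall>A B. A \<times> B \<subseteq> set_pmf P \<longrightarrow> (\<integral>\<^sup>+ z. ennreal (c z) * indicator (A \<times> B) z \<partial>P) \<le> 1)"

text \<open>The fibre over each \<open>w\<close> is the product of its own projections, so the
  certificate bounds exactly the integral required by Gibbs' inequality.\<close>

lemma markov_coupling_info_density_ge:
  assumes R: "markov_coupling P R" and fin: "finite (set_pmf P)" and c: "rectangle_bounded P c"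
    and pos: "\<And>z. z \<in> set_pmf P \<Longrightarrow> 0 < c z"
  defines "Q \<equiv> map_pmf (\<lambda>(x, y, w). ((x, y), w)) R"
  shows "map_pmf fst Q = P"
    and "measure_pmf.expectation P (\<lambda>z. log 2 (c z)) \<le> measure_pmf.expectation Q (info_density Q)"
proof -
  show P: "map_pmf fst Q = P"
    using R unfolding Q_def markov_coupling_def by (simp add: map_pmf_comp case_prod_unfold)
  have "(\<integral>\<^sup>+ z. ennreal (c z) * indicator {z. (z, w) \<in> set_pmf Q} z \<partial>P) \<le> 1" for w
  proof -
    let ?S = "{z. (z, w) \<in> set_pmf Q}"
    have S: "?S = fst ` ?S \<times> snd ` ?S"
    proof (intro equalityI subsetI)
      fix z assume "z \<in> fst ` ?S \<times> snd ` ?S"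
      then obtain x y x' y' where "z = (x, y)" "((x, y'), w) \<in> set_pmf Q" "((x', y), w) \<in> set_pmf Q"
        by auto
      moreover have "((a, b), w) \<in> set_pmf Q \<longleftrightarrow> (a, b, w) \<in> set_pmf R" for a b
        unfolding Q_def by (force simp: image_iff)
      ultimately show "z \<in> ?S"
        using markov_coupling_rectangle[OF R, of x y' w x' y] by simp
    qed (auto simp: mem_Times_iff)
    have "?S \<subseteq> set_pmf P" unfolding P[symmetric] by force
    moreover from S obtain A B where "?S = A \<times> B" by blast
    ultimately show ?thesis using c unfolding rectangle_bounded_def by simp
  qed
  then show "measure_pmf.expectation P (\<lambda>z. log 2 (c z)) \<le> measure_pmf.expectation Q (info_density Q)"
    by (intro expectation_info_density_ge[of Q c, unfolded P] fin pos)
qed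

section \<open>Tensorization of the lower bound\<close>

lemma set_pmf_iid_source:
  "set_pmf (iid_source n P) =
     (\<lambda>zs. (map fst zs, map snd zs)) ` {zs \<in> lists (set_pmf P). length zs = n}"
  unfolding iid_source_def by (simp add: set_replicate_pmf)

lemma finite_set_pmf_iid_source:
  "finite (set_pmf P) \<Longrightarrow> finite (set_pmf (iid_source n P))"
  using finite_lists_length_eq[of "set_pmf P" n] unfolding set_pmf_iid_source
  by (auto intro!: finite_imageI simp: lists_eq_set)

text \<open>Induction on the block length. The heads and the tails of a rectangle in the block
  support again form rectangles in the respective supports. Enlarging the block rectangle to the
  product of these two makes the integral factorize.\<close>

lemma rectangle_bounded_iid_source:
  assumes c: "rectangle_bounded P c" and nn: "\<And>z. 0 \<le> c z"
  shows "rectangle_bounded (iid_source n P) (\<lambda>(xs, ys). prod_list (map c (zip xs ys)))"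
proof -
  have prod_nn: "0 \<le> prod_list (map c zs)" for zs
    by (induction zs) (auto simp: nn)
  \<comment> \<open>Stated over lists of pairs, so that \<open>replicate_pmf\<close> peels off one
    letter.\<close>
  have "(\<integral>\<^sup>+ zs. ennreal (prod_list (map c zs)) * indicator (A \<times> B) (map fst zs, map snd zs) \<partial>replicate_pmf n P) \<le> 1"
    if "A \<times> B \<subseteq> set_pmf (iid_source n P)" for A B
    using that
  proof (induction n arbitrary: A B)
    case 0
    show ?case by (simp add: indicator_def)
  next
    case (Suc n)
    have rect: "hd ` A \<times> hd ` B \<subseteq> set_pmf P" "tl ` A \<times> tl ` B \<subseteq> set_pmf (iid_source n P)"
    proof -
      have "(hd a, hd b) \<in> set_pmf P \<and> (tl a, tl b) \<in> set_pmf (iid_source n P)"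
        if "a \<in> A" "b \<in> B" for a b
      proof -
        from that Suc.prems have "(a, b) \<in> set_pmf (iid_source (Suc n) P)" by auto
        then obtain zs where zs: "a = map fst zs" "b = map snd zs" "set zs \<subseteq> set_pmf P" "length zs = Suc n"
          unfolding set_pmf_iid_source by auto
        moreover from zs(4) obtain z zs' where "zs = z # zs'" by (cases zs) auto
        ultimately show ?thesis
          unfolding set_pmf_iid_source by (auto intro!: image_eqI[of _ _ zs'])
      qed
      then show "hd ` A \<times> hd ` B \<subseteq> set_pmf P" "tl ` A \<times> tl ` B \<subseteq> set_pmf (iid_source n P)"
        by auto
    qed
    let ?f = "\<lambda>z. ennreal (c z) * indicator (hd ` A \<times> hd ` B) z"
    let ?g = "\<lambda>zs. ennreal (prod_list (map c zs)) * indicator (tl ` A \<times> tl ` B) (map fst zs, map snd zs)"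
    have "(\<integral>\<^sup>+ zs. ennreal (prod_list (map c zs)) * indicator (A \<times> B) (map fst zs, map snd zs) \<partial>replicate_pmf (Suc n) P)
        = (\<integral>\<^sup>+ z. \<integral>\<^sup>+ zs. ennreal (c z * prod_list (map c zs)) * indicator (A \<times> B) (fst z # map fst zs, snd z # map snd zs)
            \<partial>replicate_pmf n P \<partial>P)"
      by simp
    also have "\<dots> \<le> (\<integral>\<^sup>+ z. \<integral>\<^sup>+ zs. ?f z * ?g zs \<partial>replicate_pmf n P \<partial>P)"
    proof (intro nn_integral_mono)
      fix z zs
      have "indicator (A \<times> B) (fst z # map fst zs, snd z # map snd zs) \<le>
          (indicator (hd ` A \<times> hd ` B) z * indicator (tl ` A \<times> tl ` B) (map fst zs, map snd zs) :: ennreal)"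
        using imageI[of "fst z # map fst zs" A hd] imageI[of "fst z # map fst zs" A tl]
          imageI[of "snd z # map snd zs" B hd] imageI[of "snd z # map snd zs" B tl]
        by (auto simp: indicator_def mem_Times_iff)
      then have "ennreal (c z) * ennreal (prod_list (map c zs)) *
          indicator (A \<times> B) (fst z # map fst zs, snd z # map snd zs) \<le>
          ennreal (c z) * ennreal (prod_list (map c zs)) *
          (indicator (hd ` A \<times> hd ` B) z * indicator (tl ` A \<times> tl ` B) (map fst zs, map snd zs))"
        by (rule mult_left_mono) simp
      then show "ennreal (c z * prod_list (map c zs)) *
          indicator (A \<times> B) (fst z # map fst zs, snd z # map snd zs) \<le> ?f z * ?g zs"
        by (simp add: ennreal_mult nn prod_nn mult_ac)
    qed
    also have "\<dots> = (\<integral>\<^sup>+ z. ?f z * (\<integral>\<^sup>+ zs. ?g zs \<partial>replicate_pmf n P) \<partial>P)"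
      by (simp add: nn_integral_cmult)
    also have "\<dots> \<le> (\<integral>\<^sup>+ z. ?f z * 1 \<partial>P)"
      by (intro nn_integral_mono mult_left_mono Suc.IH rect) auto
    also have "\<dots> \<le> 1"
      using c rect unfolding rectangle_bounded_def by simp
    finally show ?case .
  qed
  then show ?thesis
    unfolding rectangle_bounded_def iid_source_def by (simp add: zip_map_fst_snd)
qed

lemma expectation_replicate_pmf_sum_list:
  fixes f :: "'a \<Rightarrow> real"
  assumes fin: "finite (set_pmf P)"
  shows "measure_pmf.expectation (replicate_pmf n P) (\<lambda>zs. sum_list (map f zs))
       = n * measure_pmf.expectation P f"
proof (induction n)
  case (Suc n)
  have fins: "finite (set_pmf (replicate_pmf n P))"
    using finite_lists_length_eq[OF fin, of n] by (simp add: set_replicate_pmf lists_eq_set)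
  let ?D = "pair_pmf P (replicate_pmf n P)"
  have i: "integrable ?D h" for h :: "_ \<Rightarrow> real"
    by (rule integrable_measure_pmf_finite) (use fin fins in auto)
  have "replicate_pmf (Suc n) P = map_pmf (\<lambda>(x, xs). x # xs) ?D"
    by (simp add: pair_pmf_def map_bind_pmf map_pmf_def bind_assoc_pmf bind_return_pmf)
  then have "measure_pmf.expectation (replicate_pmf (Suc n) P) (\<lambda>zs. sum_list (map f zs))
      = measure_pmf.expectation ?D (\<lambda>u. f (fst u) + sum_list (map f (snd u)))"
    by (simp add: case_prod_unfold)
  also have "\<dots> = measure_pmf.expectation (map_pmf fst ?D) f
      + measure_pmf.expectation (map_pmf snd ?D) (\<lambda>zs. sum_list (map f zs))"
    by (subst Bochner_Integration.integral_add[OF i i]) (simp only: integral_map_pmf)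
  also have "\<dots> = Suc n * measure_pmf.expectation P f"
    unfolding map_fst_pair_pmf map_snd_pair_pmf Suc.IH by (simp add: algebra_simps)
  finally show ?case .
qed simp

lemma common_entropy_iid_source_ge:
  assumes fin: "finite (set_pmf P)" and c: "rectangle_bounded P c" and nn: "\<And>z. 0 \<le> c z"
    and pos: "\<And>z. z \<in> set_pmf P \<Longrightarrow> 0 < c z"
  shows "ereal (n * measure_pmf.expectation P (\<lambda>z. log 2 (c z))) \<le> common_entropy (iid_source n P)"
  unfolding common_entropy_def
proof (rule INF_greatest, clarify)
  fix R :: "('a list \<times> 'b list \<times> nat) pmf"
  assume R: "markov_coupling (iid_source n P) R"
  define Q where "Q = map_pmf (\<lambda>(x, y, w). ((x, y), w)) R"
  let ?c = "\<lambda>(xs, ys). prod_list (map c (zip xs ys))"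
  \<comment> \<open>The logarithm of the block weight is a sum over letters, whose mean is linear in
    \<open>n\<close>. The restriction to the support matters because \<open>c\<close> may vanish
    elsewhere.\<close>
  have lp: "0 < prod_list (map c zs) \<and> log 2 (prod_list (map c zs)) = sum_list (map (\<lambda>z. log 2 (c z)) zs)"
    if "set zs \<subseteq> set_pmf P" for zs
    using that by (induction zs) (auto simp: pos log_mult_pos)
  have pos': "0 < ?c z" if "z \<in> set_pmf (iid_source n P)" for z
  proof -
    from that obtain zs where "z = (map fst zs, map snd zs)" "set zs \<subseteq> set_pmf P"
      unfolding set_pmf_iid_source by auto
    then show ?thesis using lp by (simp add: zip_map_fst_snd)
  qed
  note Q = markov_coupling_info_density_ge[OF R finite_set_pmf_iid_source[OF fin]
      rectangle_bounded_iid_source[OF c nn] pos', folded Q_def]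
  have "n * measure_pmf.expectation P (\<lambda>z. log 2 (c z)) =
      measure_pmf.expectation (replicate_pmf n P) (\<lambda>zs. sum_list (map (\<lambda>z. log 2 (c z)) zs))"
    by (simp add: expectation_replicate_pmf_sum_list[OF fin])
  also have "\<dots> = measure_pmf.expectation (iid_source n P) (\<lambda>z. log 2 (?c z))"
    unfolding iid_source_def
    by (auto intro!: integral_cong_AE simp: AE_measure_pmf_iff set_replicate_pmf zip_map_fst_snd lp lists_eq_set)
  also have "\<dots> \<le> measure_pmf.expectation Q (info_density Q)" by (rule Q)
  finally have "ereal (n * measure_pmf.expectation P (\<lambda>z. log 2 (c z))) \<le>
    ereal (measure_pmf.expectation Q (info_density Q))" by simp
  also have "\<dots> \<le> shannon_entropy (map_pmf snd Q)"
    by (rule shannon_entropy_ge_info_density) (simp only: Q(1) finite_set_pmf_iid_source[OF fin])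
  also have "map_pmf snd Q = map_pmf (\<lambda>(x, y, w). w) R"
    unfolding Q_def by (simp add: map_pmf_comp case_prod_unfold)
  finally show "ereal (n * measure_pmf.expectation P (\<lambda>z. log 2 (c z)))
      \<le> shannon_entropy (map_pmf (\<lambda>(x, y, w). w) R)" .
qed

lemma wyner_common_information_ge:
  fixes P :: "('a :: finite \<times> 'b :: finite) pmf"
  assumes c: "rectangle_bounded P c" and pos: "\<And>z. z \<in> set_pmf P \<Longrightarrow> 0 < c z"
  shows "ereal (measure_pmf.expectation P (\<lambda>z. log 2 (c z))) \<le> wyner_common_information P"
  unfolding wyner_common_information_def
  by (rule INF_greatest)
    (use markov_coupling_info_density_ge(2)[OF _ _ c pos] in
      \<open>auto simp: mutual_information_eq_expectation\<close>)

text \<open>Conditional independence is built in: \<open>w\<close> is drawn from \<open>V\<close>,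
  then \<open>x\<close> and \<open>y\<close> independently from kernels. Both achievability
  constructions have this shape, so that only the law of \<open>(x, y)\<close> remains to be
  checked.\<close>

lemma
  fixes A :: "'w \<Rightarrow> 'x pmf" and B :: "'w \<Rightarrow> 'y pmf" and V :: "'w pmf"
  defines "R \<equiv> bind_pmf V (\<lambda>w. map_pmf (\<lambda>(x, y). (x, y, w)) (pair_pmf (A w) (B w)))"
  shows markov_coupling_mixture: "map_pmf (\<lambda>(x, y, w). (x, y)) R = P \<Longrightarrow> markov_coupling P R"
    and pmf_mixture: "pmf R (x, y, w) = pmf V w * (pmf (A w) x * pmf (B w) y)"
    and map_pmf_mixture: "map_pmf (\<lambda>(x, y, w). w) R = V"
proof -
  \<comment> \<open>The four events in the definition of conditional independence arise with
    \<open>S\<close> a point, a row, a column and \<open>UNIV\<close>.\<close>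
  have prob: "measure_pmf.prob R {s. (fst s, fst (snd s)) \<in> S \<and> snd (snd s) = w} =
      pmf V w * measure_pmf.prob (pair_pmf (A w) (B w)) S" for S w
  proof -
    let ?p = "measure_pmf.prob (pair_pmf (A w) (B w)) S"
    have "emeasure R {s. (fst s, fst (snd s)) \<in> S \<and> snd (snd s) = w} =
       (\<integral>\<^sup>+ v. ennreal ?p * indicator {w} v \<partial>V)"
      unfolding R_def emeasure_bind_pmf emeasure_map_pmf
      by (intro nn_integral_cong)
        (auto simp: indicator_def case_prod_unfold vimage_def measure_pmf.emeasure_eq_measure[symmetric])
    also have "\<dots> = ennreal (pmf V w * ?p)"
      by (simp add: nn_integral_cmult emeasure_pmf_single ennreal_mult mult.commute[of "pmf V w"])
    finally show ?thesis by (simp add: measure_def)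
  qed
  have fst: "measure_pmf.prob (pair_pmf (A w) (B w)) {z. fst z = x} = pmf (A w) x" for x w
    using pmf_map[of fst "pair_pmf (A w) (B w)" x] by (simp add: map_fst_pair_pmf vimage_def)
  have snd: "measure_pmf.prob (pair_pmf (A w) (B w)) {z. snd z = y} = pmf (B w) y" for y w
    using pmf_map[of snd "pair_pmf (A w) (B w)" y] by (simp add: map_snd_pair_pmf vimage_def)
  have single: "measure_pmf.prob (pair_pmf (A w) (B w)) {(x, y)} = pmf (A w) x * pmf (B w) y" for x y w
    by (simp add: measure_pmf_single pmf_pair)
  have "{s. (fst s, fst (snd s)) \<in> {(x, y)} \<and> snd (snd s) = w} = {(x, y, w)}" by auto
  then show "pmf R (x, y, w) = pmf V w * (pmf (A w) x * pmf (B w) y)"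
    using prob[of "{(x, y)}" w] by (simp add: measure_pmf_single pmf_pair)
  show "map_pmf (\<lambda>(x, y, w). w) R = V"
    unfolding R_def by (simp add: map_bind_pmf map_pmf_comp case_prod_unfold bind_return_pmf')
  assume "map_pmf (\<lambda>(x, y, w). (x, y)) R = P"
  then show "markov_coupling P R"
    unfolding markov_coupling_def cond_prob_def case_prod_unfold
    using prob[of "{(x, y)}" w for x y w] prob[of "{z. fst z = x}" w for x w]
      prob[of "{z. snd z = y}" w for y w] prob[of UNIV w for w]
    by (simp add: fst snd single)
qed

section \<open>The Wyner common information of the erasure source\<close>

text \<open>For \<open>p = 1\<close> the value at \<open>False\<close> is \<open>1 / 0 = 0\<close>,
  at a letter off the support. Hence the gain is nonnegative everywhere but positive only on the
  support.\<close>

definition erasure_gain :: "real \<Rightarrow> bool \<Rightarrow> real" where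
  "erasure_gain p e = (if 1/2 \<le> p then 1 / pmf (bernoulli_pmf p) e else 2)"

text \<open>The binary entropy of \<open>p\<close> if \<open>p \<ge> 1/2\<close>, and one bit
  otherwise: the common value of the two sides of the theorem.\<close>

definition erasure_rate :: "real \<Rightarrow> real" where
  "erasure_rate p = measure_pmf.expectation (bernoulli_pmf p) (\<lambda>e. log 2 (erasure_gain p e))"

lemma erasure_gain_nonneg: "0 \<le> erasure_gain p e"
  unfolding erasure_gain_def by simp

lemma erasure_gain_pos: "e \<in> set_pmf (bernoulli_pmf p) \<Longrightarrow> 0 < erasure_gain p e"
  unfolding erasure_gain_def by (auto simp: pmf_positive)

lemma map_pmf_erasure_source: "map_pmf (\<lambda>z. snd z = None) (erasure_source p) = bernoulli_pmf p"
  unfolding erasure_source_def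
  by (simp add: map_bind_pmf if_distrib[of "\<lambda>y. y = None"] if_bool_eq_conj bind_return_pmf')

lemma erasure_gain_source_pos:
  assumes "z \<in> set_pmf (erasure_source p)"
  shows "0 < erasure_gain p (snd z = None)"
proof (rule erasure_gain_pos)
  show "(snd z = None) \<in> set_pmf (bernoulli_pmf p)"
    using imageI[OF assms, of "\<lambda>z. snd z = None"]
    unfolding set_map_pmf[symmetric] map_pmf_erasure_source .
qed

lemma expectation_erasure_source:
  "measure_pmf.expectation (erasure_source p) (\<lambda>z. log 2 (erasure_gain p (snd z = None)))
     = erasure_rate p"
  unfolding erasure_rate_def map_pmf_erasure_source[symmetric] by simp

context
  fixes p :: real
  assumes p: "0 \<le> p" "p \<le> 1"
begin

lemma pmf_erasure_source:
  "pmf (erasure_source p) (x, y) =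
     (case y of None \<Rightarrow> p / 2 | Some b \<Rightarrow> if b = x then (1 - p) / 2 else 0)"
  unfolding erasure_source_def using p
  by (cases x; cases y; simp add: pmf_bind; auto)

text \<open>An unerased \<open>Some b\<close> in \<open>B\<close> forces \<open>x = b\<close>
  throughout \<open>A\<close>, so a rectangle lies in \<open>UNIV \<times> {None}\<close> or in
  \<open>{(b, None), (b, Some b)}\<close>. Their weights are \<open>2 * p\<close> and 1 if
  \<open>p < 1/2\<close>; otherwise both are 1, except that the second is \<open>1/2\<close> at
  \<open>p = 1\<close>.\<close>

lemma rectangle_bounded_erasure_source:
  "rectangle_bounded (erasure_source p) (\<lambda>z. erasure_gain p (snd z = None))"
  unfolding rectangle_bounded_def
proof (intro allI impI)
  fix A :: "bool set" and B
  assume AB: "A \<times> B \<subseteq> set_pmf (erasure_source p)"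
  let ?c = "\<lambda>z :: bool \<times> bool option. erasure_gain p (snd z = None)"
  have le: "(\<integral>\<^sup>+ z. ennreal (?c z) * indicator (A \<times> B) z \<partial>erasure_source p) \<le> 1"
    if D: "A \<times> B \<subseteq> D" and sum: "(\<Sum>z\<in>D. ?c z * pmf (erasure_source p) z) \<le> 1" for D
  proof -
    have "(\<integral>\<^sup>+ z. ennreal (?c z) * indicator (A \<times> B) z \<partial>erasure_source p)
        = (\<Sum>z\<in>UNIV. ennreal (?c z) * indicator (A \<times> B) z * ennreal (pmf (erasure_source p) z))"
      by (rule nn_integral_measure_pmf_support) auto
    also have "\<dots> \<le> (\<Sum>z\<in>D. ennreal (?c z) * indicator (A \<times> B) z * ennreal (pmf (erasure_source p) z))"
      using D by (intro eq_refl, intro sum.mono_neutral_right) (auto split: split_indicator)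
    also have "\<dots> \<le> (\<Sum>z\<in>D. ennreal (?c z * pmf (erasure_source p) z))"
      by (intro sum_mono) (auto simp: ennreal_mult erasure_gain_nonneg split: split_indicator)
    also have "\<dots> = ennreal (\<Sum>z\<in>D. ?c z * pmf (erasure_source p) z)"
      by (rule sum_ennreal) (simp add: erasure_gain_nonneg)
    also have "\<dots> \<le> 1" using sum by simp
    finally show ?thesis .
  qed
  have supp: "b = x" if "(x, Some b) \<in> A \<times> B" for x b
    using that AB pmf_erasure_source[of x "Some b"] by (auto simp: set_pmf_iff split: if_splits)
  have "A \<times> B \<subseteq> UNIV \<times> {None} \<or> (\<exists>b. A \<times> B \<subseteq> {(b, None), (b, Some b)})"
  proof (cases "\<exists>b. Some b \<in> B")
    case True
    then obtain b where "Some b \<in> B" by blast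
    have "z \<in> {(b, None), (b, Some b)}" if "z \<in> A \<times> B" for z
    proof -
      obtain x y where z: "z = (x, y)" by force
      with that \<open>Some b \<in> B\<close> have "x = b" using supp[of x b] by simp
      with that z supp[of x] show ?thesis by (cases y) auto
    qed
    then have "A \<times> B \<subseteq> {(b, None), (b, Some b)}" by (rule subsetI)
    then show ?thesis by (intro disjI2 exI)
  next
    case False
    then have "y = None" if "y \<in> B" for y using that by (cases y) auto
    then have "A \<times> B \<subseteq> UNIV \<times> {None}" by auto
    then show ?thesis by (rule disjI1)
  qed
  then show "(\<integral>\<^sup>+ z. ennreal (?c z) * indicator (A \<times> B) z \<partial>erasure_source p) \<le> 1"
  proof (elim disjE exE)
    assume "A \<times> B \<subseteq> UNIV \<times> {None}"
    then show ?thesis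
    proof (rule le)
      have "(\<Sum>z\<in>UNIV \<times> {None}. ?c z * pmf (erasure_source p) z) = erasure_gain p True * p"
        by (simp add: sum.cartesian_product[symmetric] UNIV_bool pmf_erasure_source)
      then show "(\<Sum>z\<in>UNIV \<times> {None}. ?c z * pmf (erasure_source p) z) \<le> 1"
        using p by (auto simp: erasure_gain_def)
    qed
  next
    fix b assume "A \<times> B \<subseteq> {(b, None), (b, Some b)}"
    then show ?thesis
    proof (rule le)
      show "(\<Sum>z\<in>{(b, None), (b, Some b)}. ?c z * pmf (erasure_source p) z) \<le> 1"
        using p by (cases "p = 1") (auto simp: erasure_gain_def pmf_erasure_source pmf_le_1 field_simps)
    qed
  qed
qed

text \<open>
  \<open>W\<close> is a copy of \<open>X\<close> (encoded as \<open>0\<close>, \<open>1\<close>) or an erasure (encoded as \<open>2\<close>), and \<open>Y\<close> is obtained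
  from \<open>W\<close> by a further erasure with probability \<open>min p (1/2)\<close>.
\<close>

lemma wyner_common_information_erasure_source_le:
  "wyner_common_information (erasure_source p) \<le> erasure_rate p"
proof -
  \<comment> \<open>Here \<open>a\<close> is the probability that \<open>W\<close> is not erased;
    \<open>a * (1 - q) = 1 - p\<close> makes the two successive erasures combine to probability
    \<open>p\<close>. For \<open>p \<le> 1/2\<close> one has \<open>a = 1\<close>, so
    \<open>W\<close> is just \<open>X\<close>.\<close>
  define q where "q = min p (1/2)"
  define a where "a = (1 - p) / (1 - q)"
  have q: "0 \<le> q" "q \<le> 1/2" and a: "0 \<le> a" "a \<le> 1" and aq: "a * (1 - q) = 1 - p"
    using p unfolding q_def a_def by (auto simp: field_simps)
  define V :: "nat pmf" where
    "V = do {u \<leftarrow> bernoulli_pmf a; b \<leftarrow> bernoulli_pmf (1/2); return_pmf (if u then of_bool b else 2)}"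
  define A where "A w = (if w = 2 then bernoulli_pmf (1/2) else return_pmf (w = 1))" for w :: nat
  define B where "B w = (if w = 2 then return_pmf None
      else map_pmf (\<lambda>e. if e then None else Some (w = 1)) (bernoulli_pmf q))" for w :: nat
  define R where "R = bind_pmf V (\<lambda>w. map_pmf (\<lambda>(x, y). (x, y, w)) (pair_pmf (A w) (B w)))"
  define Q where "Q = map_pmf (\<lambda>(x, y, w). ((x, y), w)) R"
  have pmfA: "pmf (A w) x = (if w = 2 then 1/2 else of_bool (x = (w = 1)))" for w x
    unfolding A_def by (cases x) auto
  have pmfB: "pmf (B w) y = (if w = 2 then of_bool (y = None)
      else case y of None \<Rightarrow> q | Some b \<Rightarrow> if b = (w = 1) then 1 - q else 0)" for w y
    unfolding B_def map_pmf_def using q by (cases y) (auto simp: pmf_bind)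
  have P: "map_pmf (\<lambda>(x, y, w). (x, y)) R = erasure_source p"
  proof (rule pmf_eqI)
    fix z :: "bool \<times> bool option"
    obtain x y where z: "z = (x, y)" by force
    have "map_pmf (\<lambda>(x, y, w). (x, y)) R = bind_pmf V (\<lambda>w. pair_pmf (A w) (B w))"
      unfolding R_def by (simp add: map_bind_pmf map_pmf_comp case_prod_unfold)
    then have "pmf (map_pmf (\<lambda>(x, y, w). (x, y)) R) (x, y) =
        measure_pmf.expectation V (\<lambda>w. pmf (A w) x * pmf (B w) y)"
      by (simp add: pmf_bind pmf_pair)
    also have "\<dots> = measure_pmf.expectation (pair_pmf (bernoulli_pmf a) (bernoulli_pmf (1/2)))
        (\<lambda>(u, b). pmf (A (if u then of_bool b else 2)) x * pmf (B (if u then of_bool b else 2)) y)"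
    proof -
      have "V = map_pmf (\<lambda>(u, b). if u then of_bool b else 2) (pair_pmf (bernoulli_pmf a) (bernoulli_pmf (1/2)))"
        unfolding V_def pair_pmf_def by (simp add: map_bind_pmf)
      then show ?thesis by (simp add: case_prod_unfold)
    qed
    also have "\<dots> = (\<Sum>u\<in>UNIV. \<Sum>b\<in>UNIV. pmf (bernoulli_pmf a) u * pmf (bernoulli_pmf (1/2)) b *
        (pmf (A (if u then of_bool b else 2)) x * pmf (B (if u then of_bool b else 2)) y))"
      by (subst integral_measure_pmf[of UNIV])
        (auto simp: sum.cartesian_product UNIV_Times_UNIV pmf_pair intro!: sum.cong)
    also have "\<dots> = pmf (erasure_source p) (x, y)"
      using a aq by (cases x; cases y) (simp_all add: UNIV_bool pmfA pmfB pmf_erasure_source field_simps)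
    finally show "pmf (map_pmf (\<lambda>(x, y, w). (x, y)) R) z = pmf (erasure_source p) z"
      using z by simp
  qed
  have markov: "markov_coupling (erasure_source p) R"
    using markov_coupling_mixture[OF P[unfolded R_def]] unfolding R_def .
  have fstQ: "map_pmf fst Q = erasure_source p"
    unfolding Q_def P[symmetric] by (simp add: map_pmf_comp case_prod_unfold)
  have sndQ: "map_pmf snd Q = V"
    using map_pmf_mixture[of V A B] unfolding Q_def R_def by (simp add: map_pmf_comp case_prod_unfold)
  have pmfQ: "pmf Q ((x, y), w) = pmf V w * (pmf (A w) x * pmf (B w) y)" for x y w
  proof -
    have "inj (\<lambda>(x, y, w). ((x, y), w))" by (auto simp: inj_def)
    from pmf_map_inj'[OF this, of R "(x, y, w)"] show ?thesis
      unfolding Q_def using pmf_mixture[of V A B x y w] by (simp add: R_def)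
  qed
  \<comment> \<open>Equality in Gibbs' inequality: the density is the logarithm of the gain on the
    whole support.\<close>
  have dens: "info_density Q zw = log 2 (erasure_gain p (snd (fst zw) = None))" if "zw \<in> set_pmf Q" for zw
  proof -
    obtain x y w where zw: "zw = ((x, y), w)" by (metis prod.exhaust)
    have pos: "0 < pmf V w * (pmf (A w) x * pmf (B w) y)" "0 < pmf (erasure_source p) (x, y)"
      using pmf_marginal_pos[OF that[unfolded zw]] unfolding fstQ pmfQ by auto
    then have posAB: "0 < pmf V w" "0 < pmf (A w) x" "0 < pmf (B w) y"
      by (auto simp: less_le)
    \<comment> \<open>For \<open>0 < p < 1/2\<close> the ratio at \<open>w = 2\<close> would be
      \<open>1 / p\<close> instead of 2, so this value must be excluded there.\<close>
    have "w = 2 \<Longrightarrow> 1/2 < p"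
    proof (rule ccontr)
      assume w: "w = 2" and "\<not> 1/2 < p"
      then have "a = 1" using p unfolding a_def q_def by (auto simp: field_simps)
      moreover have "2 \<in> set_pmf V" using pos w by (auto simp: set_pmf_iff)
      ultimately show False unfolding V_def
        by (auto simp: set_pmf_iff[of _ "bernoulli_pmf 1"] of_bool_def split: if_splits)
    qed
    then have "pmf (A w) x * pmf (B w) y / pmf (erasure_source p) (x, y) = erasure_gain p (y = None)"
      using posAB(2,3) pos(2) p
      by (cases "w = 2"; cases "p \<ge> 1/2"; cases y)
        (simp_all add: pmfA pmfB pmf_erasure_source erasure_gain_def q_def min_def field_simps
          split: if_splits)
    moreover have "info_density Q zw = log 2 (pmf (A w) x * pmf (B w) y / pmf (erasure_source p) (x, y))"
      using posAB unfolding info_density_def fstQ sndQ by (simp add: zw pmfQ)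
    ultimately show ?thesis by (simp add: zw)
  qed
  have "wyner_common_information (erasure_source p) \<le>
      ereal (prob_space.mutual_information (measure_pmf R) 2 (count_space UNIV) (count_space UNIV)
          (\<lambda>(x, y, w). w) (\<lambda>(x, y, w). (x, y)))"
    unfolding wyner_common_information_def by (rule INF_lower) (simp add: markov)
  also have "prob_space.mutual_information (measure_pmf R) 2 (count_space UNIV) (count_space UNIV)
          (\<lambda>(x, y, w). w) (\<lambda>(x, y, w). (x, y)) = measure_pmf.expectation Q (info_density Q)"
    unfolding mutual_information_eq_expectation Q_def ..
  also have "\<dots> = measure_pmf.expectation Q (\<lambda>zw. log 2 (erasure_gain p (snd (fst zw) = None)))"
    by (intro integral_cong_AE) (simp_all add: AE_measure_pmf_iff dens)
  also have "\<dots> = measure_pmf.expectation (map_pmf fst Q) (\<lambda>z. log 2 (erasure_gain p (snd z = None)))"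
    by simp
  also have "\<dots> = erasure_rate p"
    unfolding fstQ by (rule expectation_erasure_source)
  finally show ?thesis .
qed

lemma wyner_common_information_erasure_source:
  "wyner_common_information (erasure_source p) = erasure_rate p"
  using wyner_common_information_erasure_source_le
    wyner_common_information_ge[OF rectangle_bounded_erasure_source erasure_gain_source_pos]
  by (simp add: expectation_erasure_source)

lemma common_entropy_iid_erasure_source_ge:
  "ereal (n * erasure_rate p) \<le> common_entropy (iid_source n (erasure_source p))"
  using common_entropy_iid_source_ge[OF _ rectangle_bounded_erasure_source erasure_gain_nonneg
      erasure_gain_source_pos, of n]
  by (simp add: expectation_erasure_source)

end

section \<open>Covering families\<close>

text \<open>By double counting, some \<open>b\<close> is related to at least a fraction
  \<open>\<rho>\<close> of the elements still uncovered; adding it leaves at most a fraction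
  \<open>1 - \<rho>\<close> of them.\<close>

lemma greedy_cover:
  fixes \<rho> :: real
  assumes A: "finite A" and B: "finite B" "B \<noteq> {}" and \<rho>: "0 \<le> \<rho>" "\<rho> \<le> 1"
    and deg: "\<And>a. a \<in> A \<Longrightarrow> \<rho> * card B \<le> card {b \<in> B. r a b}"
  shows "\<exists>C \<subseteq> B. card C \<le> k \<and> card {a \<in> A. \<forall>b\<in>C. \<not> r a b} \<le> (1 - \<rho>) ^ k * card A"
proof (induction k)
  case 0
  show ?case by (intro exI[of _ "{}"]) auto
next
  case (Suc k)
  then obtain C where C: "C \<subseteq> B" "card C \<le> k" "card {a \<in> A. \<forall>b\<in>C. \<not> r a b} \<le> (1 - \<rho>) ^ k * card A"
    by blast
  define U where "U = {a \<in> A. \<forall>b\<in>C. \<not> r a b}"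
  have U: "finite U" "U \<subseteq> A" unfolding U_def using A by auto
  have "\<exists>C' \<subseteq> B. card C' \<le> Suc k \<and> card {a \<in> A. \<forall>b\<in>C'. \<not> r a b} \<le> (1 - \<rho>) * card U"
  proof -
    have "\<rho> * card U * card B \<le> (\<Sum>a\<in>U. real (card {b \<in> B. r a b}))"
      using sum_mono[of U "\<lambda>_. \<rho> * card B" "\<lambda>a. real (card {b \<in> B. r a b})"] deg U
      by (auto simp: mult_ac)
    also have "\<dots> = (\<Sum>b\<in>B. real (card {a \<in> U. r a b}))"
      using sum.swap_restrict[OF U(1) B(1), of "\<lambda>_ _. 1 :: real" r] by simp
    finally have "\<exists>b\<in>B. \<rho> * card U \<le> card {a \<in> U. r a b}"
    proof (rule contrapos_pp)
      assume "\<not> (\<exists>b\<in>B. \<rho> * card U \<le> card {a \<in> U. r a b})"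
      then have "(\<Sum>b\<in>B. real (card {a \<in> U. r a b})) < (\<Sum>b\<in>B. \<rho> * card U)"
        using B by (intro sum_strict_mono) (auto simp: not_le)
      then show "\<not> \<rho> * card U * card B \<le> (\<Sum>b\<in>B. real (card {a \<in> U. r a b}))"
        by (simp add: mult_ac)
    qed
    then obtain b where b: "b \<in> B" "\<rho> * card U \<le> card {a \<in> U. r a b}" by blast
    have eq: "{a \<in> A. \<forall>b\<in>insert b C. \<not> r a b} = U - {a \<in> U. r a b}"
      unfolding U_def by auto
    have "real (card (U - {a \<in> U. r a b})) = card U - real (card {a \<in> U. r a b})"
      using U card_mono[OF U(1), of "{a \<in> U. r a b}"] by (subst card_Diff_subset) (auto simp: of_nat_diff)
    also have "\<dots> \<le> (1 - \<rho>) * card U" using b by (simp add: algebra_simps)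
    finally have "real (card {a \<in> A. \<forall>b\<in>insert b C. \<not> r a b}) \<le> (1 - \<rho>) * card U"
      unfolding eq .
    moreover have "card (insert b C) \<le> Suc k"
      using card_insert_le_m1[of "Suc k" C b] C by simp
    ultimately show ?thesis using b C by (intro exI[of _ "insert b C"]) auto
  qed
  moreover have "(1 - \<rho>) * card U \<le> (1 - \<rho>) ^ Suc k * card A"
    using mult_left_mono[OF C(3), of "1 - \<rho>"] \<rho> unfolding U_def by (simp add: mult_ac)
  ultimately show ?case by (metis (no_types, lifting) order_trans)
qed

text \<open>Both sides count the nested pairs of an \<open>m\<close>-set inside a
  \<open>2 * m\<close>-set, choosing either the small set or the large set first.\<close>

lemma binomial_ratio:
  assumes "2 * m \<le> n"
  shows "(n - m choose m) * (n choose m) = (2 * m choose m) * (n choose (2 * m))"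
proof -
  have "(n choose (2 * m)) * (2 * m choose m) = (n choose m) * (n - m choose (2 * m - m))"
    by (rule choose_mult) (use assms in auto)
  then show ?thesis by (simp add: mult_ac mult_2)
qed

lemma card_supersets_of_size:
  assumes N: "finite N" and T: "T \<subseteq> N" and k: "card T \<le> k"
  shows "card {S. S \<subseteq> N \<and> card S = k \<and> T \<subseteq> S} = (card N - card T choose (k - card T))"
proof -
  have fT: "finite T" using N T finite_subset by blast
  have "bij_betw (\<lambda>S. S \<union> T) {S. S \<subseteq> N - T \<and> card S = k - card T} {S. S \<subseteq> N \<and> card S = k \<and> T \<subseteq> S}"
  proof (rule bij_betw_byWitness[where f' = "\<lambda>S. S - T"])
    show "(\<lambda>S. S \<union> T) ` {S. S \<subseteq> N - T \<and> card S = k - card T} \<subseteq> {S. S \<subseteq> N \<and> card S = k \<and> T \<subseteq> S}"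
    proof clarify
      fix S assume S: "S \<subseteq> N - T" "card S = k - card T"
      have "card (S \<union> T) = card S + card T"
        using S N fT by (intro card_Un_disjoint) (auto intro: finite_subset)
      then show "S \<union> T \<subseteq> N \<and> card (S \<union> T) = k \<and> T \<subseteq> S \<union> T"
        using S T k by auto
    qed
    show "(\<lambda>S. S - T) ` {S. S \<subseteq> N \<and> card S = k \<and> T \<subseteq> S} \<subseteq> {S. S \<subseteq> N - T \<and> card S = k - card T}"
      using fT by (auto simp: card_Diff_subset)
  qed auto
  from bij_betw_same_card[OF this] show ?thesis
    using n_subsets[of "N - T" "k - card T"] N T fT by (simp add: card_Diff_subset)
qed

text \<open>Greedy covering, with \<open>\<rho>\<close> the fraction of \<open>2 * m\<close>-sets
  that contain a given \<open>m\<close>-set. One factor \<open>n + 1\<close> pays for the number of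
  rounds, the other for \<open>4 ^ m \<le> (n + 1) * (2 * m choose m)\<close>.\<close>

lemma exists_small_cover:
  assumes n: "0 < n" and m: "2 * m \<le> n"
  shows "\<exists>C. C \<subseteq> {S. S \<subseteq> {..<n} \<and> card S = 2 * m} \<and>
      real (card C) * 4 ^ m \<le> real ((n + 1) * (n + 1)) * real (n choose m) \<and>
      (\<forall>T. T \<subseteq> {..<n} \<and> card T = m \<longrightarrow> (\<exists>S\<in>C. T \<subseteq> S))"
proof -
  let ?A = "{T. T \<subseteq> {..<n} \<and> card T = m}" and ?B = "{S. S \<subseteq> {..<n} \<and> card S = 2 * m}"
  define \<rho> where "\<rho> = real (2 * m choose m) / real (n choose m)"
  have cA: "card ?A = (n choose m)" and cB: "card ?B = (n choose (2 * m))"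
    using n_subsets[of "{..<n}"] by simp_all
  have fin: "finite ?A" "finite ?B" by simp_all
  have posm: "0 < (n choose m)" "0 < (2 * m choose m)" "0 < (n choose (2 * m))"
    using m by (simp_all add: zero_less_binomial)
  have le: "(2 * m choose m) \<le> (n choose m)"
    using m by (rule binomial_right_mono)
  have \<rho>: "0 < \<rho>" "\<rho> \<le> 1"
    using posm le unfolding \<rho>_def by simp_all
  have deg: "\<rho> * card ?B \<le> card {S \<in> ?B. T \<subseteq> S}" if "T \<in> ?A" for T
  proof -
    have "{S \<in> ?B. T \<subseteq> S} = {S. S \<subseteq> {..<n} \<and> card S = 2 * m \<and> T \<subseteq> S}" by auto
    then have "card {S \<in> ?B. T \<subseteq> S} = (n - m choose m)"
      using card_supersets_of_size[of "{..<n}" T "2 * m"] that by (simp add: mult_2)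
    moreover have "real (n - m choose m) * real (n choose m) = real (2 * m choose m) * real (n choose (2 * m))"
      using binomial_ratio[OF m] by (metis of_nat_mult)
    ultimately show ?thesis
      using posm unfolding \<rho>_def cB by (simp add: field_simps)
  qed
  \<comment> \<open>After at least \<open>n / \<rho>\<close> rounds, at most
    \<open>exp (- n) * 2 ^ n\<close> sets are uncovered. As \<open>n > 0\<close>, this is less than
    1, so none is left.\<close>
  define k where "k = nat \<lceil>n / \<rho>\<rceil>"
  have k: "n \<le> \<rho> * k" "k \<le> n / \<rho> + 1"
  proof -
    have "n / \<rho> \<le> k" unfolding k_def by (rule real_nat_ceiling_ge)
    then show "n \<le> \<rho> * k" using \<rho> by (simp add: field_simps)
    show "k \<le> n / \<rho> + 1" unfolding k_def using \<rho> n
      by (simp add: of_nat_nat ceiling_le_iff)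
  qed
  have "?B \<noteq> {}" using cB posm by (metis card.empty less_irrefl)
  then obtain C where C: "C \<subseteq> ?B" "card C \<le> k"
    "card {T \<in> ?A. \<forall>S\<in>C. \<not> T \<subseteq> S} \<le> (1 - \<rho>) ^ k * card ?A"
    using greedy_cover[of ?A ?B \<rho> "(\<subseteq>)" k] fin \<rho> deg by auto
  have "(1 - \<rho>) ^ k \<le> exp (- \<rho>) ^ k"
    using \<rho> exp_ge_add_one_self[of "- \<rho>"] by (intro power_mono) auto
  also have "\<dots> = exp (- (\<rho> * k))" by (simp add: exp_of_nat_mult[symmetric] mult.commute)
  also have "\<dots> \<le> exp (- real n)" using k by simp
  finally have "(1 - \<rho>) ^ k * card ?A \<le> exp (- real n) * card ?A"
    by (intro mult_right_mono) auto
  also have "\<dots> \<le> exp (- real n) * 2 ^ n"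
  proof (rule mult_left_mono)
    have "real (n choose m) \<le> real (2 ^ n)"
      using binomial_le_pow2[of n m] by (simp only: of_nat_le_iff)
    then show "real (card ?A) \<le> 2 ^ n" unfolding cA by simp
  qed simp
  also have "\<dots> < exp (- real n) * exp 1 ^ n"
  proof -
    have "exp (ln 2) < exp (1 :: real)" using ln_2_less_1 by (simp only: exp_less_cancel_iff)
    then show ?thesis using n by (intro mult_strict_left_mono power_strict_mono) simp_all
  qed
  also have "\<dots> = 1" by (simp add: exp_of_nat_mult[symmetric] exp_minus)
  finally have "card {T \<in> ?A. \<forall>S\<in>C. \<not> T \<subseteq> S} < 1"
    using C(3) by linarith
  then have "card {T \<in> ?A. \<forall>S\<in>C. \<not> T \<subseteq> S} = 0" by linarith
  moreover have "finite {T \<in> ?A. \<forall>S\<in>C. \<not> T \<subseteq> S}" using fin(1) by simp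
  ultimately have "{T \<in> ?A. \<forall>S\<in>C. \<not> T \<subseteq> S} = {}" by (simp only: card_0_eq)
  then have cover: "\<exists>S\<in>C. T \<subseteq> S" if "T \<subseteq> {..<n}" "card T = m" for T
    using that by blast
  have "real (card C) \<le> n / \<rho> + 1 / \<rho>"
  proof -
    have "1 \<le> 1 / \<rho>" using \<rho> by simp
    moreover have "real (card C) \<le> real k" using C(2) by (simp only: of_nat_le_iff)
    ultimately show ?thesis using k(2) by linarith
  qed
  also have "\<dots> = (n + 1) * (n choose m) / (2 * m choose m)"
    using posm unfolding \<rho>_def by (simp add: field_simps)
  finally have cC: "real (card C) * (2 * m choose m) \<le> (n + 1) * (n choose m)"
    using posm by (simp add: field_simps)
  have central: "4 ^ m \<le> real (n + 1) * (2 * m choose m)"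
  proof (cases "m = 0")
    case False
    then have "4 ^ m \<le> real (2 * m) * (2 * m choose m)"
      using central_binomial_lower_bound[of m] by (simp add: field_simps)
    also have "\<dots> \<le> real (n + 1) * (2 * m choose m)"
      using m by (intro mult_right_mono) simp_all
    finally show ?thesis .
  qed simp
  have "real (card C) * 4 ^ m \<le> real (card C) * (real (n + 1) * (2 * m choose m))"
    using central by (intro mult_left_mono) auto
  also have "\<dots> = real (n + 1) * (real (card C) * (2 * m choose m))" by (simp add: mult_ac)
  also have "\<dots> \<le> real (n + 1) * ((n + 1) * (n choose m))"
    using cC by (intro mult_left_mono) auto
  finally have "real (card C) * 4 ^ m \<le> real ((n + 1) * (n + 1)) * real (n choose m)"
    by (simp only: of_nat_mult mult.assoc)
  then show ?thesis using C(1) cover by (intro exI[of _ C]) blast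
qed

section \<open>Common entropy from markings\<close>

definition erase_at :: "bool list \<Rightarrow> bool list \<Rightarrow> bool option list" where
  "erase_at x e = map2 (\<lambda>x e. if e then None else Some x) x e"

text \<open>Hidden bits become \<open>False\<close>: the list reveals only the marked bits, yet
  keeps length and positions.\<close>

definition clip :: "bool list \<Rightarrow> bool list \<Rightarrow> bool list" where
  "clip s b = map2 (\<and>) s b"

definition merge :: "bool list \<Rightarrow> bool list \<Rightarrow> bool list \<Rightarrow> bool list" where
  "merge s b x = map2 (\<lambda>(s, b) x. if s then b else x) (zip s b) x"

definition ones :: "bool list \<Rightarrow> nat" where
  "ones s = length (filter id s)"

section \<open>Bits, erasures and partial disclosure\<close>

lemma iid_source_Suc:
  "iid_source (Suc n) P =
     bind_pmf P (\<lambda>z. bind_pmf (iid_source n P) (\<lambda>zs. return_pmf (fst z # fst zs, snd z # snd zs)))"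
  unfolding iid_source_def by (simp add: map_bind_pmf bind_map_pmf)

lemma iid_erasure_source:
  "iid_source n (erasure_source p) =
     bind_pmf (replicate_pmf n (bernoulli_pmf (1/2))) (\<lambda>x.
       bind_pmf (replicate_pmf n (bernoulli_pmf p)) (\<lambda>e. return_pmf (x, erase_at x e)))"
proof (induction n)
  case 0
  show ?case by (simp add: iid_source_def erase_at_def bind_return_pmf)
next
  case (Suc n)
  let ?X = "bernoulli_pmf (1/2)" and ?E = "bernoulli_pmf p"
  have "iid_source (Suc n) (erasure_source p) =
     bind_pmf ?X (\<lambda>x. bind_pmf ?E (\<lambda>e. bind_pmf (replicate_pmf n ?X) (\<lambda>xs.
       bind_pmf (replicate_pmf n ?E) (\<lambda>es. return_pmf (x # xs, erase_at (x # xs) (e # es))))))"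
    unfolding iid_source_Suc Suc.IH
    by (simp add: erasure_source_def bind_assoc_pmf bind_return_pmf erase_at_def)
  also have "\<dots> =
     bind_pmf ?X (\<lambda>x. bind_pmf (replicate_pmf n ?X) (\<lambda>xs. bind_pmf ?E (\<lambda>e.
       bind_pmf (replicate_pmf n ?E) (\<lambda>es. return_pmf (x # xs, erase_at (x # xs) (e # es))))))"
    by (intro bind_pmf_cong refl bind_commute_pmf)
  finally show ?case by (simp add: bind_assoc_pmf bind_return_pmf)
qed

text \<open>In an i.i.d. block, drawing the unmarked bits afresh does not change the joint law of
  the revealed bits and the block. The arbitrary continuation \<open>k\<close> expresses this joint
  law and lets the induction prepend a letter.\<close>

lemma resample_unrevealed:
  assumes "length s = n"
  shows "bind_pmf (replicate_pmf n q) (\<lambda>b. bind_pmf (replicate_pmf n q) (\<lambda>x. k (clip s b) (merge s (clip s b) x)))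
     = bind_pmf (replicate_pmf n q) (\<lambda>x. k (clip s x) x)"
  using assms
proof (induction n arbitrary: s k)
  case 0
  then show ?case by (simp add: bind_return_pmf clip_def merge_def)
next
  case (Suc n)
  then obtain t s' where s: "s = t # s'" and len: "length s' = n" by (cases s) auto
  let ?X = "replicate_pmf n q"
  show ?case
  proof (cases t)
    case True
    have "bind_pmf q (\<lambda>u. bind_pmf ?X (\<lambda>b. bind_pmf ?X (\<lambda>x. k (u # clip s' b) (u # merge s' (clip s' b) x))))
       = bind_pmf q (\<lambda>u. bind_pmf ?X (\<lambda>x. k (u # clip s' x) (u # x)))"
      by (intro bind_pmf_cong refl Suc.IH[OF len])
    then show ?thesis
      using True unfolding s by (simp add: bind_assoc_pmf bind_return_pmf clip_def merge_def)
  next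
    case False
    have "bind_pmf ?X (\<lambda>b. bind_pmf q (\<lambda>u. bind_pmf ?X (\<lambda>x. k (False # clip s' b) (u # merge s' (clip s' b) x))))
       = bind_pmf q (\<lambda>u. bind_pmf ?X (\<lambda>b. bind_pmf ?X (\<lambda>x. k (False # clip s' b) (u # merge s' (clip s' b) x))))"
      by (rule bind_commute_pmf)
    also have "\<dots> = bind_pmf q (\<lambda>u. bind_pmf ?X (\<lambda>x. k (False # clip s' x) (u # x)))"
      by (intro bind_pmf_cong refl Suc.IH[OF len])
    finally show ?thesis
      using False unfolding s by (simp add: bind_assoc_pmf bind_return_pmf clip_def merge_def)
  qed
qed

text \<open>Disintegration of \<open>M\<close> along \<open>f\<close>; it allows the erasure pattern
  to be drawn when only its marks are known.\<close>

lemma bind_map_cond_pmf: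
  "bind_pmf (map_pmf f M) (\<lambda>s. cond_pmf M {e. f e = s}) = M"
proof (rule bind_cond_pmf_cancel)
  fix s e assume "f e = s"
  then have "{s. f e = s} = {s}" by auto
  then show "measure_pmf.prob M {e. f e = s} = measure_pmf.prob (map_pmf f M) {s. f e = s}"
    by (simp add: measure_pmf_single pmf_map vimage_def)
qed auto

text \<open>The bits hidden by \<open>clip\<close> are erased anyway.\<close>

lemma erase_at_clip:
  assumes "list_all2 (\<lambda>e s. \<not> e \<longrightarrow> s) e s"
  shows "erase_at (clip s x) e = erase_at x e"
  using assms
proof (induction arbitrary: x rule: list_all2_induct)
  case (Cons e es s ss)
  then show ?case by (cases x) (auto simp: erase_at_def clip_def)
qed (simp add: erase_at_def clip_def)

section \<open>Entropy bounds from code lengths\<close>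

lemma shannon_entropy_map_inj:
  assumes "inj f"
  shows "shannon_entropy (map_pmf f q) = shannon_entropy q"
  unfolding shannon_entropy_def by (simp add: pmf_map_inj'[OF assms] del: pmf_map)

text \<open>Gibbs' inequality against the subprobability \<open>2 powr - l w\<close>. The lengths
  are arbitrary reals, so no actual code is constructed.\<close>

lemma shannon_entropy_le_of_kraft:
  assumes fin: "finite (set_pmf q)" and kraft: "(\<Sum>w\<in>set_pmf q. 2 powr - l w) \<le> (1 :: real)"
  shows "shannon_entropy q \<le> ereal (measure_pmf.expectation q l)"
proof -
  let ?h = "\<lambda>w. - log 2 (pmf q w)"
  have int: "integrable q g" for g :: "_ \<Rightarrow> real"
    using fin by (rule integrable_measure_pmf_finite)
  have nn: "AE w in q. 0 \<le> ?h w"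
    by (auto simp: AE_measure_pmf_iff pmf_positive pmf_le_1)
  have "shannon_entropy q = ereal (measure_pmf.expectation q ?h)"
    unfolding shannon_entropy_def nn_integral_eq_integral[OF int nn]
    by (rule enn2ereal_ennreal) (rule integral_nonneg_AE[OF nn])
  moreover have "measure_pmf.expectation q ?h - measure_pmf.expectation q l \<le> 0"
  proof -
    have "measure_pmf.expectation q ?h - measure_pmf.expectation q l =
        (\<Sum>w\<in>set_pmf q. pmf q w * (?h w - l w))"
      by (simp add: integral_measure_pmf[OF fin] right_diff_distrib sum_subtractf sum_negf)
    also have "\<dots> \<le> (\<Sum>w\<in>set_pmf q. (2 powr - l w - pmf q w) / ln 2)"
    proof (rule sum_mono)
      fix w assume "w \<in> set_pmf q"
      then have pos: "0 < pmf q w" by (rule pmf_positive)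
      have "?h w - l w = - (- log 2 (2 powr - l w / pmf q w))"
        using pos by (simp add: log_divide)
      also have "\<dots> \<le> - ((1 - 2 powr - l w / pmf q w) / ln 2)"
        using log2_inverse_ge[of "2 powr - l w / pmf q w"] pos by simp
      finally have "pmf q w * (?h w - l w) \<le> pmf q w * - ((1 - 2 powr - l w / pmf q w) / ln 2)"
        using pos by (intro mult_left_mono) auto
      also have "\<dots> = (2 powr - l w - pmf q w) / ln 2"
        using pos by (simp add: field_simps)
      finally show "pmf q w * (?h w - l w) \<le> (2 powr - l w - pmf q w) / ln 2" .
    qed
    also have "\<dots> = ((\<Sum>w\<in>set_pmf q. 2 powr - l w) - 1) / ln 2"
      using sum_pmf_eq_1[OF fin order_refl]
      by (simp add: sum_divide_distrib[symmetric] sum_subtractf)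
    also have "\<dots> \<le> 0" using kraft by (simp add: divide_nonpos_pos)
    finally show ?thesis .
  qed
  ultimately show ?thesis by simp
qed

lemma card_clip_le: "card (clip s ` {b. length b = length s}) \<le> 2 ^ ones s"
proof (induction s)
  case (Cons t s)
  let ?C = "clip s ` {b. length b = length s}"
  have fin: "finite ?C" using finite_lists_length_eq[of "UNIV :: bool set" "length s"] by simp
  have "clip (t # s) ` {b. length b = length (t # s)} \<subseteq> (\<Union>u. (#) (t \<and> u) ` ?C)"
  proof
    fix c assume "c \<in> clip (t # s) ` {b. length b = length (t # s)}"
    then obtain u b where "c = clip (t # s) (u # b)" "length b = length s"
      by (auto simp: length_Suc_conv)
    then show "c \<in> (\<Union>u. (#) (t \<and> u) ` ?C)"
      by (auto simp: clip_def)
  qed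
  also have "(\<Union>u. (#) (t \<and> u) ` ?C) = (if t then (#) True ` ?C else {}) \<union> (#) False ` ?C"
    by (auto simp: UNIV_bool)
  finally have "card (clip (t # s) ` {b. length b = length (t # s)}) \<le>
      card ((if t then (#) True ` ?C else {}) \<union> (#) False ` ?C)"
    using fin by (intro card_mono) auto
  also have "\<dots> \<le> (if t then card ?C else 0) + card ?C"
    using fin by (intro order_trans[OF card_Un_le] add_mono) (auto intro: card_image_le)
  also have "\<dots> \<le> 2 ^ ones (t # s)"
    using Cons.IH by (auto simp: ones_def)
  finally show ?case .
qed (simp add: clip_def ones_def)

text \<open>Lengths of a three-part description: the number of marks, the index of the marking among
  those with that number, and the marked bits. The bits of one marking contribute a factor at most
  1, a class with equal \<open>ones\<close> then at most \<open>1 / (n + 1)\<close>, and there are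
  at most \<open>n + 1\<close> classes.\<close>

lemma kraft_clip:
  assumes fin: "finite F" and len: "\<And>s. s \<in> F \<Longrightarrow> length s = n"
  shows "(\<Sum>w\<in>Sigma F (\<lambda>s. clip s ` {b. length b = length s}).
    2 powr - (ones (fst w) + log 2 (card {t \<in> F. ones t = ones (fst w)}) + log 2 (real (n + 1)))) \<le> 1"
proof -
  define l where "l s = ones s + log 2 (card {t \<in> F. ones t = ones s}) + log 2 (real (n + 1))" for s
  let ?C = "\<lambda>s. clip s ` {b. length b = length s}"
  let ?D = "\<lambda>j. {t \<in> F. ones t = j}"
  have finC: "finite (?C s)" for s :: "bool list" using finite_lists_length_eq[of "UNIV :: bool set" "length s"] by simp
  have "(\<Sum>w\<in>Sigma F ?C. 2 powr - l (fst w)) = (\<Sum>s\<in>F. \<Sum>b\<in>?C s. 2 powr - l s)"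
    using fin finC by (subst sum.Sigma) (auto simp: case_prod_unfold)
  also have "\<dots> \<le> (\<Sum>s\<in>F. 1 / (real (card (?D (ones s))) * (n + 1)))"
  proof (rule sum_mono)
    fix s assume s: "s \<in> F"
    then have "card (?D (ones s)) \<noteq> 0" using fin by auto
    then have "2 powr - l s = 1 / (2 ^ ones s * (real (card (?D (ones s))) * (n + 1)))"
      unfolding l_def powr_minus_divide by (simp add: powr_add powr_realpow)
    then have "(\<Sum>b\<in>?C s. 2 powr - l s) = real (card (?C s)) / 2 ^ ones s * (1 / (real (card (?D (ones s))) * (n + 1)))"
      by simp
    also have "\<dots> \<le> 1 * (1 / (real (card (?D (ones s))) * (n + 1)))"
    proof (rule mult_right_mono)
      have "real (card (?C s)) \<le> real (2 ^ ones s)" using card_clip_le[of s] by (simp only: of_nat_le_iff)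
      then show "real (card (?C s)) / 2 ^ ones s \<le> 1" by simp
    qed simp
    finally show "(\<Sum>b\<in>?C s. 2 powr - l s) \<le> 1 / (real (card (?D (ones s))) * (n + 1))" by simp
  qed
  also have "\<dots> = (\<Sum>j\<in>ones ` F. \<Sum>s\<in>?D j. 1 / (real (card (?D j)) * (n + 1)))"
    using fin by (subst sum.image_gen[of F _ ones]) (auto intro!: sum.cong)
  also have "\<dots> \<le> (\<Sum>j\<in>ones ` F. 1 / (n + 1))"
    by (intro sum_mono) (simp add: field_simps)
  also have "\<dots> = card (ones ` F) / (n + 1)" by simp
  also have "\<dots> \<le> 1"
  proof -
    have "ones ` F \<subseteq> {..n}" using len unfolding ones_def by (auto intro: order_trans[OF length_filter_le])
    then have "card (ones ` F) \<le> n + 1" using card_mono[of "{..n}"] by fastforce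
    then have "real (card (ones ` F)) \<le> real (n + 1)" by (simp only: of_nat_le_iff)
    then show ?thesis by simp
  qed
  finally show ?thesis unfolding l_def .
qed

text \<open>
  \<open>f e\<close> marks a set of positions containing the unerased ones, and \<open>W\<close> consists of \<open>f e\<close> and of the
  bits of \<open>X\<close> at the marked positions.  Given \<open>W\<close>, the source \<open>X\<close> is uniform off the marked
  positions whereas \<open>Y\<close> depends only on which \<open>e\<close> gave rise to the marks.
\<close>

lemma common_entropy_le_of_marking:
  fixes n :: nat and p :: real
  defines "M \<equiv> replicate_pmf n (bernoulli_pmf p)"
  assumes f: "\<And>e. e \<in> set_pmf M \<Longrightarrow> list_all2 (\<lambda>e s. \<not> e \<longrightarrow> s) e (f e)"
  shows "common_entropy (iid_source n (erasure_source p)) \<le>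
    ereal (measure_pmf.expectation M (\<lambda>e. ones (f e) +
      log 2 (card {s \<in> f ` set_pmf M. ones s = ones (f e)}) + log 2 (real (n + 1))))"
proof -
  define X where "X = replicate_pmf n (bernoulli_pmf (1/2))"
  define V where "V = bind_pmf (map_pmf f M) (\<lambda>s. map_pmf (\<lambda>b. (s, clip s b)) X)"
  define A where "A w = map_pmf (merge (fst w) (snd w)) X" for w
  define B where "B w = map_pmf (erase_at (snd w)) (cond_pmf M {e. f e = fst w})" for w
  have finM: "finite (set_pmf M)"
    unfolding M_def using finite_lists_length_eq[of "set_pmf (bernoulli_pmf p)" n]
    by (simp add: set_replicate_pmf lists_eq_set)
  have lenM: "length e = n" if "e \<in> set_pmf M" for e
    using that unfolding M_def by (simp add: set_replicate_pmf)
  have len: "length (f e) = n" if "e \<in> set_pmf M" for e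
    using list_all2_lengthD[OF f[OF that]] lenM[OF that] by simp
  have "bind_pmf V (\<lambda>w. pair_pmf (A w) (B w)) =
      bind_pmf (map_pmf f M) (\<lambda>s. bind_pmf X (\<lambda>b. bind_pmf X (\<lambda>x.
        bind_pmf (cond_pmf M {e. f e = s}) (\<lambda>e. return_pmf (merge s (clip s b) x, erase_at (clip s b) e)))))"
    unfolding V_def A_def B_def pair_pmf_def by (simp add: bind_assoc_pmf bind_map_pmf)
  \<comment> \<open>Revealed bits together with fresh hidden ones are again one copy of
    \<open>X\<close>.\<close>
  also have "\<dots> = bind_pmf (map_pmf f M) (\<lambda>s. bind_pmf X (\<lambda>x.
        bind_pmf (cond_pmf M {e. f e = s}) (\<lambda>e. return_pmf (x, erase_at (clip s x) e))))"
    unfolding X_def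
    by (intro bind_pmf_cong refl resample_unrevealed
        [where k = "\<lambda>b x. bind_pmf (cond_pmf M {e. f e = s}) (\<lambda>e. return_pmf (x, erase_at b e))" for s])
      (auto simp: len)
  \<comment> \<open>The marks contain all unerased positions, so the full block yields the same
    \<open>Y\<close>.\<close>
  also have "\<dots> = bind_pmf (map_pmf f M) (\<lambda>s. bind_pmf X (\<lambda>x.
        bind_pmf (cond_pmf M {e. f e = s}) (\<lambda>e. return_pmf (x, erase_at x e))))"
  proof (intro bind_pmf_cong refl)
    fix s x e assume s: "s \<in> set_pmf (map_pmf f M)" and "e \<in> set_pmf (cond_pmf M {e. f e = s})"
    moreover from s have "set_pmf M \<inter> {e. f e = s} \<noteq> {}" by auto
    ultimately have e: "e \<in> set_pmf M" "f e = s" by (auto simp: set_cond_pmf)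
    then show "return_pmf (x, erase_at (clip s x) e) = return_pmf (x, erase_at x e)"
      using erase_at_clip[OF f[OF e(1)]] by simp
  qed
  \<comment> \<open>The bits no longer depend on the marks and can be drawn first; the marks then
    average out.\<close>
  also have "\<dots> = bind_pmf X (\<lambda>x. bind_pmf (map_pmf f M) (\<lambda>s.
        bind_pmf (cond_pmf M {e. f e = s}) (\<lambda>e. return_pmf (x, erase_at x e))))"
    by (rule bind_commute_pmf)
  also have "\<dots> = bind_pmf X (\<lambda>x. bind_pmf M (\<lambda>e. return_pmf (x, erase_at x e)))"
    by (simp only: bind_assoc_pmf[symmetric] bind_map_cond_pmf)
  also have "\<dots> = iid_source n (erasure_source p)"
    unfolding iid_erasure_source X_def M_def ..
  finally have source: "bind_pmf V (\<lambda>w. pair_pmf (A w) (B w)) = iid_source n (erasure_source p)" .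

  \<comment> \<open>\<open>W\<close> is moved to the alphabet \<open>nat\<close>, and the kernels
    decode it.\<close>
  define R where "R = bind_pmf (map_pmf to_nat V)
    (\<lambda>w. map_pmf (\<lambda>(x, y). (x, y, w)) (pair_pmf (A (from_nat w)) (B (from_nat w))))"
  have "map_pmf (\<lambda>(x, y, w). (x, y)) R = iid_source n (erasure_source p)"
    unfolding R_def source[symmetric]
    by (simp add: map_bind_pmf bind_map_pmf map_pmf_comp case_prod_unfold)
  then have "markov_coupling (iid_source n (erasure_source p)) R"
    unfolding R_def by (rule markov_coupling_mixture)
  then have "common_entropy (iid_source n (erasure_source p)) \<le> shannon_entropy (map_pmf (\<lambda>(x, y, w). w) R)"
    unfolding common_entropy_def by (intro INF_lower) simp
  also have "\<dots> = shannon_entropy V"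
    unfolding R_def map_pmf_mixture by (rule shannon_entropy_map_inj) simp
  also have "\<dots> \<le> ereal (measure_pmf.expectation V (\<lambda>w. ones (fst w) +
      log 2 (card {s \<in> f ` set_pmf M. ones s = ones (fst w)}) + log 2 (real (n + 1))))"
  proof (rule shannon_entropy_le_of_kraft)
    let ?S = "Sigma (f ` set_pmf M) (\<lambda>s. clip s ` {b. length b = length s})"
    have sub: "set_pmf V \<subseteq> ?S"
      unfolding V_def X_def by (auto simp: set_replicate_pmf len)
    have finS: "finite ?S"
      using finM finite_lists_length_eq[of "UNIV :: bool set"] by (intro finite_SigmaI) auto
    show "finite (set_pmf V)" using sub finS by (rule finite_subset)
    show "(\<Sum>w\<in>set_pmf V. 2 powr - (ones (fst w) +
      log 2 (card {s \<in> f ` set_pmf M. ones s = ones (fst w)}) + log 2 (real (n + 1)))) \<le> 1"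
      by (rule order_trans[OF sum_mono2[OF finS sub] kraft_clip[of "f ` set_pmf M" n]]) (use finM len in auto)
  qed
  also have "measure_pmf.expectation V (\<lambda>w. ones (fst w) +
      log 2 (card {s \<in> f ` set_pmf M. ones s = ones (fst w)}) + log 2 (real (n + 1))) =
    measure_pmf.expectation (map_pmf fst V) (\<lambda>s. ones s +
      log 2 (card {t \<in> f ` set_pmf M. ones t = ones s}) + log 2 (real (n + 1)))"
    by simp
  also have "map_pmf fst V = map_pmf f M"
    unfolding V_def by (simp add: map_bind_pmf map_pmf_comp bind_return_pmf')
  finally show ?thesis by simp
qed

section \<open>The common entropy rate of the erasure source\<close>

definition marks :: "nat \<Rightarrow> nat set \<Rightarrow> bool list" where
  "marks n S = map (\<lambda>i. i \<in> S) [0..<n]"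

lemma ones_marks:
  assumes "S \<subseteq> {..<n}"
  shows "ones (marks n S) = card S"
proof -
  have "{i. i < n \<and> i \<in> S} = S" using assms by auto
  then show ?thesis
    unfolding ones_def marks_def by (simp add: length_filter_conv_card cong: conj_cong)
qed

lemma ones_replicate: "ones (replicate n True) = n"
  by (simp add: ones_def)

section \<open>Cost of marking compared with the probability of the erasure pattern\<close>

lemma prod_list_pmf_bernoulli:
  assumes "0 \<le> p" "p \<le> 1"
  shows "prod_list (map (pmf (bernoulli_pmf p)) e) =
     p ^ (length e - length (filter Not e)) * (1 - p) ^ length (filter Not e)"
proof (induction e)
  case (Cons b e)
  then show ?case using assms length_filter_le[of Not e] by (simp add: Suc_diff_le)
qed simp

text \<open>Pair each of the \<open>n - m\<close> erasures with an unerased position. A pair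
  contributes \<open>4 * (p * (1 - p)) \<le> 1\<close>, and each unpaired position
  \<open>2 * (1 - p) \<le> 1\<close>.\<close>

lemma bernoulli_weight_le:
  fixes p :: real
  assumes p: "1/2 \<le> p" "p \<le> 1" and m: "n \<le> 2 * m" "m \<le> n"
  shows "2 ^ n * (p ^ (n - m) * (1 - p) ^ m) \<le> 1"
proof -
  define i j where "i = 2 * m - n" and "j = n - m"
  have m_eq: "m = i + j" and n_eq: "n = i + 2 * j" and j: "n - m = j"
    using m unfolding i_def j_def by simp_all
  have "2 ^ n * (p ^ (n - m) * (1 - p) ^ m) = (2 * (1 - p)) ^ i * (4 * (p * (1 - p))) ^ j"
    unfolding j unfolding m_eq n_eq
    by (simp add: power_add power_mult power_mult_distrib del: right_diff_distrib_numeral)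
  also have "\<dots> \<le> 1 * 1"
  proof (intro mult_mono power_le_one)
    show "4 * (p * (1 - p)) \<le> 1" using zero_le_square[of "p - 1/2"] by (simp add: algebra_simps)
  qed (use p in auto)
  finally show ?thesis by simp
qed

context
  fixes p :: real and n :: nat
  assumes p: "0 \<le> p" "p \<le> 1" and n: "0 < n"
begin

lemma set_pmf_replicate_bernoulli:
  assumes "e \<in> set_pmf (replicate_pmf n (bernoulli_pmf p))"
  shows "length e = n" "set e \<subseteq> set_pmf (bernoulli_pmf p)"
    "0 < prod_list (map (pmf (bernoulli_pmf p)) e)"
proof -
  show "length e = n" and e: "set e \<subseteq> set_pmf (bernoulli_pmf p)"
    using assms by (auto simp: set_replicate_pmf)
  show "0 < prod_list (map (pmf (bernoulli_pmf p)) e)"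
    using e by (induction e) (auto simp: pmf_positive)
qed

lemma finite_set_pmf_replicate_bernoulli: "finite (set_pmf (replicate_pmf n (bernoulli_pmf p)))"
  using finite_lists_length_eq[of "set_pmf (bernoulli_pmf p)" n]
  by (simp add: set_replicate_pmf lists_eq_set)

text \<open>For \<open>p \<ge> 1/2\<close> the gain of a letter is its inverse probability, so the
  budget for marking is the self-information of the pattern.\<close>

lemma sum_list_log_erasure_gain:
  assumes "1/2 \<le> p" and "e \<in> set_pmf (replicate_pmf n (bernoulli_pmf p))"
  shows "sum_list (map (\<lambda>e. log 2 (erasure_gain p e)) e) =
    - log 2 (prod_list (map (pmf (bernoulli_pmf p)) e))"
proof -
  have "set e \<subseteq> set_pmf (bernoulli_pmf p) \<Longrightarrow>
      0 < prod_list (map (pmf (bernoulli_pmf p)) e) \<and>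
      sum_list (map (\<lambda>e. log 2 (erasure_gain p e)) e) = - log 2 (prod_list (map (pmf (bernoulli_pmf p)) e))"
  proof (induction e)
    case (Cons b e)
    then have "0 < pmf (bernoulli_pmf p) b" by (auto intro: pmf_positive)
    with Cons show ?case
      using \<open>1/2 \<le> p\<close> by (simp add: erasure_gain_def log_mult log_divide)
  qed simp
  with set_pmf_replicate_bernoulli(2)[OF assms(2)] show ?thesis by blast
qed

text \<open>Averaging reduces the upper bound to an estimate for each pattern. The third logarithm
  is the cost of describing the number of marks.\<close>

lemma common_entropy_le_of_cheap_marking:
  assumes f: "\<And>e. e \<in> set_pmf (replicate_pmf n (bernoulli_pmf p)) \<Longrightarrow>
      list_all2 (\<lambda>e s. \<not> e \<longrightarrow> s) e (f e)"
    and cheap: "\<And>e. e \<in> set_pmf (replicate_pmf n (bernoulli_pmf p)) \<Longrightarrow>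
      ones (f e) + log 2 (card {s \<in> f ` set_pmf (replicate_pmf n (bernoulli_pmf p)). ones s = ones (f e)})
      \<le> sum_list (map (\<lambda>e. log 2 (erasure_gain p e)) e) + 2 * log 2 (real (n + 1))"
  shows "common_entropy (iid_source n (erasure_source p)) \<le> ereal (n * erasure_rate p + 3 * log 2 (real (n + 1)))"
proof -
  let ?M = "replicate_pmf n (bernoulli_pmf p)"
  have int: "integrable ?M g" for g :: "_ \<Rightarrow> real"
    using finite_set_pmf_replicate_bernoulli by (rule integrable_measure_pmf_finite)
  have "common_entropy (iid_source n (erasure_source p)) \<le>
    ereal (measure_pmf.expectation ?M (\<lambda>e. ones (f e) +
      log 2 (card {s \<in> f ` set_pmf ?M. ones s = ones (f e)}) + log 2 (real (n + 1))))"
    by (rule common_entropy_le_of_marking[OF f])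
  also have "measure_pmf.expectation ?M (\<lambda>e. ones (f e) +
      log 2 (card {s \<in> f ` set_pmf ?M. ones s = ones (f e)}) + log 2 (real (n + 1))) \<le>
    measure_pmf.expectation ?M (\<lambda>e. sum_list (map (\<lambda>e. log 2 (erasure_gain p e)) e) + 3 * log 2 (real (n + 1)))"
    by (rule integral_mono_AE[OF int int]) (use cheap in \<open>force simp: AE_measure_pmf_iff\<close>)
  also have "\<dots> = n * erasure_rate p + 3 * log 2 (real (n + 1))"
    unfolding erasure_rate_def
    by (subst Bochner_Integration.integral_add[OF int int])
      (simp add: expectation_replicate_pmf_sum_list)
  finally show ?thesis by simp
qed

lemma common_entropy_iid_erasure_source_le:
  "common_entropy (iid_source n (erasure_source p)) \<le> ereal (n * erasure_rate p + 3 * log 2 (real (n + 1)))"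
proof (cases "1/2 \<le> p")
  case False
  show ?thesis
  \<comment> \<open>Below \<open>1/2\<close> the rate is one bit per letter, so \<open>W\<close> may
    reveal the whole of \<open>X\<close>.\<close>
  proof (rule common_entropy_le_of_cheap_marking[where f = "\<lambda>_. replicate n True"])
    fix e assume e: "e \<in> set_pmf (replicate_pmf n (bernoulli_pmf p))"
    note len = set_pmf_replicate_bernoulli(1)[OF e]
    then show "list_all2 (\<lambda>e s. \<not> e \<longrightarrow> s) e (replicate n True)"
      by (simp add: list_all2_conv_all_nth)
    let ?S = "{s \<in> (\<lambda>_. replicate n True) ` set_pmf (replicate_pmf n (bernoulli_pmf p)). ones s = ones (replicate n True)}"
    have "?S = {replicate n True}" using e by auto
    then have "card ?S = 1" by simp
    moreover have "sum_list (map (\<lambda>e. log 2 (erasure_gain p e)) e) = n"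
      using False len by (simp add: erasure_gain_def sum_list_triv)
    moreover have "0 \<le> log 2 (real (n + 1))" by simp
    ultimately show "ones (replicate n True) + log 2 (card ?S) \<le>
        sum_list (map (\<lambda>e. log 2 (erasure_gain p e)) e) + 2 * log 2 (real (n + 1))"
      unfolding ones_replicate by simp
  qed
next
  case True
  let ?M = "replicate_pmf n (bernoulli_pmf p)"
  define K where "K m = (SOME C. C \<subseteq> {S. S \<subseteq> {..<n} \<and> card S = 2 * m} \<and>
      real (card C) * 4 ^ m \<le> real ((n + 1) * (n + 1)) * real (n choose m) \<and>
      (\<forall>T. T \<subseteq> {..<n} \<and> card T = m \<longrightarrow> (\<exists>S\<in>C. T \<subseteq> S)))" for m
  note K' = someI_ex[OF exists_small_cover[OF n], folded K_def]
  have K: "K m \<subseteq> {S. S \<subseteq> {..<n} \<and> card S = 2 * m}"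
    "real (card (K m)) * 4 ^ m \<le> real ((n + 1) * (n + 1)) * real (n choose m)"
    "T \<subseteq> {..<n} \<Longrightarrow> card T = m \<Longrightarrow> \<exists>S\<in>K m. T \<subseteq> S" if "2 * m \<le> n" for m T
    using K'[OF that] by simp_all
  define T where "T e = {i. i < n \<and> \<not> e ! i}" for e
  define m where "m e = length (filter Not e)" for e
  have T: "T e \<subseteq> {..<n}" "length e = n \<Longrightarrow> card (T e) = m e" for e
    unfolding T_def m_def by (auto simp: length_filter_conv_card)
  define S where "S e = (SOME S. S \<in> K (m e) \<and> T e \<subseteq> S)" for e
  have S: "S e \<in> K (m e)" "T e \<subseteq> S e" if "length e = n" "2 * m e \<le> n" for e
    using someI_ex[of "\<lambda>S. S \<in> K (m e) \<and> T e \<subseteq> S"] K(3)[OF that(2) T(1) T(2)[OF that(1)]]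
    unfolding S_def by blast+
  \<comment> \<open>The strict comparison makes \<open>ones\<close> tell the branches apart: it is
    \<open>2 * m e\<close>, below \<open>n\<close>, in the first and \<open>n\<close> in the second.
    In the first branch it thus also determines \<open>m e\<close>.\<close>
  define f where "f e = (if 2 * m e < n then marks n (S e) else replicate n True)" for e
  have ones_f: "ones (f e) = (if 2 * m e < n then 2 * m e else n)" if "length e = n" for e
  proof (cases "2 * m e < n")
    case lt: True
    then have "S e \<in> {S. S \<subseteq> {..<n} \<and> card S = 2 * m e}"
      by (intro subsetD[OF K(1) S(1)[OF that]]) simp_all
    then have "S e \<subseteq> {..<n}" "card (S e) = 2 * m e" by simp_all
    then show ?thesis using lt unfolding f_def by (simp add: ones_marks)
  qed (simp add: f_def ones_replicate)
  show ?thesis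
  proof (rule common_entropy_le_of_cheap_marking[where f = f])
    fix e assume e: "e \<in> set_pmf ?M"
    note len = set_pmf_replicate_bernoulli(1)[OF e]
    show "list_all2 (\<lambda>e s. \<not> e \<longrightarrow> s) e (f e)"
    proof (cases "2 * m e < n")
      case lt: True
      then have "T e \<subseteq> S e" using S(2)[OF len] by simp
      then show ?thesis using len lt unfolding f_def marks_def T_def
        by (auto simp: list_all2_conv_all_nth)
    qed (use len in \<open>simp add: f_def list_all2_conv_all_nth\<close>)
    let ?D = "{s \<in> f ` set_pmf ?M. ones s = ones (f e)}"
    let ?P = "prod_list (map (pmf (bernoulli_pmf p)) e)"
    have D_pos: "0 < card ?D"
      using finite_set_pmf_replicate_bernoulli e by (auto simp: card_gt_0_iff)
    have P: "?P = p ^ (n - m e) * (1 - p) ^ m e"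
      using prod_list_pmf_bernoulli[OF p, of e] unfolding m_def len .
    have P_pos: "0 < ?P" by (rule set_pmf_replicate_bernoulli(3)[OF e])
    have m_le: "m e \<le> n" using length_filter_le[of Not e] len unfolding m_def by simp
    have C_pos: "0 < real (n choose m e)" using m_le by (simp add: zero_less_binomial)
    show "ones (f e) + log 2 (card ?D) \<le>
        sum_list (map (\<lambda>e. log 2 (erasure_gain p e)) e) + 2 * log 2 (real (n + 1))"
    proof (cases "2 * m e < n")
      case lt: True
      \<comment> \<open>Equally many marks mean equally many unerased positions, so all these
        markings come from the same covering family.\<close>
      have "?D \<subseteq> marks n ` K (m e)"
      proof
        fix s assume "s \<in> ?D"
        then obtain e' where e': "e' \<in> set_pmf ?M" "s = f e'" "ones (f e') = ones (f e)" by auto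
        note len' = set_pmf_replicate_bernoulli(1)[OF e'(1)]
        have "2 * m e' < n" "m e' = m e"
          using e'(3) lt unfolding ones_f[OF len] ones_f[OF len'] by (auto split: if_splits)
        then show "s \<in> marks n ` K (m e)"
          using S(1)[OF len'] unfolding e'(2) f_def by auto
      qed
      moreover have "finite (K (m e))"
        using K(1)[of "m e"] lt by (intro finite_subset[of "K (m e)" "Pow {..<n}"]) auto
      ultimately have "card ?D \<le> card (K (m e))"
        by (meson card_image_le card_mono finite_imageI le_trans)
      with D_pos have D: "0 < real (card ?D)" "real (card ?D) \<le> real (card (K (m e)))" by simp_all
      have "ones (f e) + log 2 (card ?D) = log 2 (real (card ?D) * 4 ^ m e)"
      proof -
        have "(4 :: real) ^ m e = 2 ^ (2 * m e)" by (simp add: power_mult)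
        then show ?thesis using D lt by (simp add: ones_f[OF len] log_mult log_nat_power)
      qed
      also have "\<dots> \<le> log 2 (real ((n + 1) * (n + 1)) * real (n choose m e))"
      proof (rule log_mono)
        have "real (card ?D) * 4 ^ m e \<le> card (K (m e)) * (4 :: real) ^ m e"
          using D by (intro mult_right_mono) auto
        also have "\<dots> \<le> real ((n + 1) * (n + 1)) * real (n choose m e)"
          using K(2)[of "m e"] lt by simp
        finally show "real (card ?D) * 4 ^ m e \<le> real ((n + 1) * (n + 1)) * real (n choose m e)" .
      qed (use D in simp_all)
      also have "\<dots> = log 2 (n choose m e) + 2 * log 2 (real (n + 1))"
        unfolding of_nat_mult using C_pos
        by (subst log_mult_pos, simp, simp)+
      also have "log 2 (n choose m e) \<le> - log 2 ?P"
      proof -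
        \<comment> \<open>This is one term of the binomial expansion of
          \<open>((1 - p) + p) ^ n\<close>.\<close>
        have "(n choose m e) * ?P \<le> (\<Sum>k\<le>n. (n choose k) * (1 - p) ^ k * p ^ (n - k))"
          using member_le_sum[of "m e" "{..n}" "\<lambda>k. (n choose k) * (1 - p) ^ k * p ^ (n - k)"] p m_le
          unfolding P by (simp add: mult_ac)
        also have "\<dots> = 1" using binomial_ring[of "1 - p" p n] by simp
        finally have "log 2 ((n choose m e) * ?P) \<le> 0"
          using mult_pos_pos[OF C_pos P_pos] by simp
        moreover have "log 2 ((n choose m e) * ?P) = log 2 (n choose m e) + log 2 ?P"
          by (rule log_mult_pos[OF C_pos P_pos])
        ultimately show ?thesis by simp
      qed
      finally show ?thesis using sum_list_log_erasure_gain[OF True e] by simp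
    next
      case ge: False
      have "?D \<subseteq> {replicate n True}"
      proof
        fix s assume "s \<in> ?D"
        then obtain e' where e': "e' \<in> set_pmf ?M" "s = f e'" "ones (f e') = ones (f e)" by auto
        note len' = set_pmf_replicate_bernoulli(1)[OF e'(1)]
        have "\<not> 2 * m e' < n"
          using e'(3) ge unfolding ones_f[OF len] ones_f[OF len'] by (auto split: if_splits)
        then show "s \<in> {replicate n True}" unfolding e'(2) f_def by simp
      qed
      then have "card ?D \<le> 1" using card_mono[of "{replicate n True}" ?D] by simp
      then have D: "log 2 (card ?D) \<le> 0"
        using D_pos by simp
      \<comment> \<open>At least half of the positions are unerased, so the pattern carries at least
        \<open>n\<close> bits, which pay for revealing the whole block.\<close>
      have "2 ^ n * ?P \<le> 1"
        using bernoulli_weight_le[OF True p(2), of n "m e"] ge m_le unfolding P by simp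
      then have "log 2 (2 ^ n * ?P) \<le> 0" using P_pos by simp
      then have "n \<le> - log 2 ?P" using P_pos by (simp add: log_mult_pos log_nat_power)
      moreover have "0 \<le> log 2 (real (n + 1))" by simp
      moreover have "ones (f e) = n" using ge by (simp add: ones_f[OF len])
      ultimately show ?thesis
        using D unfolding sum_list_log_erasure_gain[OF True e] by linarith
    qed
  qed
qed

end

theorem theorem1:
  fixes p :: real
  assumes "0 \<le> p" and "p \<le> 1"
  shows "common_entropy_rate (erasure_source p) = wyner_common_information (erasure_source p)"
proof -
  let ?G = "\<lambda>n. common_entropy (iid_source n (erasure_source p))" and ?L = "erasure_rate p"
  \<comment> \<open>The normalized common entropy is squeezed with an error of
    \<open>3 * log 2 (n + 1) / n\<close>; \<open>n = 0\<close>, where the division is degenerate, is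
    discarded as an eventual property suffices.\<close>
  have "(\<lambda>n. ?G n / ereal (real n)) \<longlonglongrightarrow> ereal ?L"
  proof (rule tendsto_sandwich)
    show "\<forall>\<^sub>F n in sequentially. ereal ?L \<le> ?G n / ereal (real n)"
      using eventually_gt_at_top[of 0]
    proof eventually_elim
      case (elim n)
      have "ereal ?L = ereal (n * ?L) / ereal n" using elim by simp
      also have "\<dots> \<le> ?G n / ereal n"
        using elim by (intro ereal_divide_right_mono common_entropy_iid_erasure_source_ge assms) auto
      finally show ?case .
    qed
    show "\<forall>\<^sub>F n in sequentially. ?G n / ereal (real n) \<le> ereal (?L + 3 * log 2 (real (n + 1)) / n)"
      using eventually_gt_at_top[of 0]
    proof eventually_elim
      case (elim n)
      have "?G n / ereal n \<le> ereal (n * ?L + 3 * log 2 (real (n + 1))) / ereal n"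
        using elim by (intro ereal_divide_right_mono common_entropy_iid_erasure_source_le assms) auto
      also have "\<dots> = ereal (?L + 3 * log 2 (real (n + 1)) / n)"
        using elim by (simp add: field_simps)
      finally show ?case .
    qed
    have "(\<lambda>n. ?L + 3 * log 2 (real (n + 1)) / real n) \<longlonglongrightarrow> ?L" by real_asymp
    then show "(\<lambda>n. ereal (?L + 3 * log 2 (real (n + 1)) / real n)) \<longlonglongrightarrow> ereal ?L" by simp
  qed simp
  then have "common_entropy_rate (erasure_source p) = ereal ?L"
    unfolding common_entropy_rate_def by (rule limI)
  then show ?thesis
    using wyner_common_information_erasure_source[OF assms] by simp
qed

end
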